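(* Let $(n,r,b)\neq(6,3,11)$ be an ordered triple of positive integers such that $1\leq b\leq\binom{n}{r}$ and $b\leq\binom{r+3}{3}$. Then an $(n,r,b)$-matrix exists.
   Context: All matrices have entries in $\mathbb{C}$. An $(n,r,b)$-matrix is an $r\times n$ matrix with exactly $b$ invertible $r\times r$ submatrices (i.e. exactly $b$ of the $\binom{n}{r}$ choices of $r$ columns give an invertible matrix). The condition $1\le b\leq\binom{n}{r}$ implicitly forces $r\leq n$. *)

theory Defs
  imports Complex_Main "Jordan_Normal_Form.DL_Submatrix"
begin

(* Columns are indexed from 0, and submatrix A UNIV J keeps all rows of A and the columns with
   index in J, in increasing order. The count is of choices of r column positions: two different
   sets J are counted separately even if they give equal submatrices. *)
definition nrb_matrix :: "nat \<Rightarrow> nat \<Rightarrow> nat \<Rightarrow> complex mat \<Rightarrow> bool" where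
  "nrb_matrix n r b A \<longleftrightarrow>
     A \<in> carrier_mat r n \<and>
     card {J. J \<subseteq> {..<n} \<and> card J = r \<and> invertible_mat (submatrix A UNIV J)} = b"

end

theory Submission
  imports Defs "Jordan_Normal_Form.Determinant" "HOL-Library.Code_Binary_Nat"
begin

text \<open>
  Appending zero columns does not change the number of bases. As \<open>b \<le> (r + 3) choose r\<close>, it is
  therefore enough to treat \<open>n = r + c\<close> with \<open>c \<le> 3\<close>. The complements of the bases of a matrix of
  rank \<open>c\<close> with \<open>n\<close> columns are the bases of a matrix with \<open>n - c\<close> rows whose rows span the kernel
  (\<open>dual_bases\<close>), so the question becomes which numbers are numbers of bases in rank at most three.
  Ranks zero and one are immediate, and in rank two the bases are the pairs of elements from different
  parallel classes (\<open>realizable_rank_2\<close>).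

  In rank three one may assume that \<open>b\<close> exceeds \<open>(N - 1) choose 3\<close>, where \<open>N\<close> is the number of columns,
  since otherwise a column can be dropped; so exactly \<open>d < (N - 1) choose 2\<close> triples of columns have to be
  dependent. Consider arrangements in the projective plane that consist of a point, the apex, some lines
  through the apex, and some points on these lines, each occupied by a class of parallel columns and
  otherwise in general position (\<open>arrangement_realizable\<close>). A line with \<open>k\<close> simple points besides the apex
  has \<open>(k + 1) choose 3\<close> dependent triples. Suppose that the arrangement consists of such lines
  and of classes of sizes \<open>m\<^sub>i\<close> on further lines of their own. If \<open>L\<close> is the number of dependent
  triples on the lines with simple points, \<open>s\<close> the sum of the numbers \<open>m\<^sub>i choose 2\<close>, and \<open>t\<close> the sum of the numbers
  \<open>m\<^sub>i choose 3\<close>, then the number of dependent triples is \<open>(N - 2) s - 2 t + L\<close> (\<open>stacked_add_class\<close>).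
  Given \<open>d\<close>, take for \<open>s\<close> the quotient of \<open>d\<close> by \<open>N - 2\<close>, decompose \<open>s\<close> greedily into binomial
  coefficients \<open>m choose 2\<close>, and then decompose the required \<open>L\<close> greedily into binomial coefficients
  \<open>(k + 1) choose 3\<close>. For \<open>N \<ge> 30\<close> this always needs at most \<open>N\<close> points (\<open>config_large\<close>). For smaller \<open>N\<close> a value
  of \<open>s\<close> close to the quotient works, with a short list of exceptions (\<open>small_cases\<close>). All exceptions
  except two are settled by individual arrangements with an apex; the two others have \<open>N = 6\<close>. One of them is
  \<open>d = 3\<close>, settled by a triangle, and the other is \<open>d = 9\<close>, which is the excluded triple. As this triple also blocks
  the passage from seven to six columns, eleven bases on seven columns get their own arrangement.
\<close>

section \<open>Bases of a matrix\<close>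

definition free_cols :: "nat \<Rightarrow> (nat \<Rightarrow> nat \<Rightarrow> complex) \<Rightarrow> nat set \<Rightarrow> bool" where
  "free_cols r a J \<longleftrightarrow>
     (\<forall>z. (\<forall>i<r. (\<Sum>e\<in>J. z e * a i e) = 0) \<longrightarrow> (\<forall>e\<in>J. z e = 0))"

lemma free_colsD:
  assumes "free_cols r a J" and "\<And>i. i < r \<Longrightarrow> (\<Sum>e\<in>J. z e * a i e) = 0" and "e \<in> J"
  shows "z e = 0"
  using assms unfolding free_cols_def by simp

lemma invertible_iff_det:
  assumes A: "A \<in> carrier_mat r r"
  shows "invertible_mat (A :: 'a :: field mat) \<longleftrightarrow> det A \<noteq> 0"
proof
  assume "invertible_mat A"
  then obtain B where B: "inverts_mat A B" "inverts_mat B A"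
    unfolding invertible_mat_def by blast
  have AB: "A * B = 1\<^sub>m r"
    using B(1) A by (simp add: inverts_mat_def)
  have BA: "B * A = 1\<^sub>m (dim_row B)"
    using B(2) by (simp add: inverts_mat_def)
  have "dim_col B = r"
    using AB by (metis index_mult_mat(3) index_one_mat(3))
  moreover have "dim_row B = r"
    using BA A by (metis carrier_matD(2) index_mult_mat(3) index_one_mat(3))
  ultimately have "B \<in> carrier_mat r r" by auto
  with AB A have "det A * det B = 1"
    by (metis det_mult det_one)
  then show "det A \<noteq> 0" by auto
next
  assume "det A \<noteq> 0"
  from det_non_zero_imp_unit[OF A this]
  obtain B where "B \<in> carrier_mat r r" "A * B = 1\<^sub>m r" "B * A = 1\<^sub>m r"
    by (auto simp: Units_def ring_mat_def)
  with A show "invertible_mat A"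
    unfolding invertible_mat_def inverts_mat_def by (intro conjI exI[of _ B]) auto
qed

text \<open>
  This allows sums over the columns of a submatrix to be written as sums over the set of their positions in
  the full matrix.
\<close>

lemma bij_betw_pick:
  assumes "finite J"
  shows "bij_betw (pick J) {..<card J} J"
proof (rule bij_betw_imageI)
  show "inj_on (pick J) {..<card J}"
    by (rule inj_onI) (metis card_pick_le lessThan_iff)
  have "j \<in> pick J ` {..<card J}" if "j \<in> J" for j
  proof -
    have "{a\<in>J. a < j} \<subset> J" using that by auto
    then have "card {a\<in>J. a < j} < card J"
      by (rule psubset_card_mono[OF assms])
    then show ?thesis using pick_card_in_set[OF that] by force
  qed
  then show "pick J ` {..<card J} = J"
    using pick_in_set_le by fastforce
qed

lemma submatrix_all_rows:
  assumes "A \<in> carrier_mat r n" and "J \<subseteq> {..<n}" and "card J = r"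
  shows "submatrix A UNIV J = mat r r (\<lambda>(i,j). A $$ (i, pick J j))"
proof -
  have "{i. i < r \<and> i \<in> UNIV} = {..<r}" "{j. j < n \<and> j \<in> J} = J"
    using assms(2) by auto
  then show ?thesis
    using assms by (simp add: submatrix_def pick_UNIV)
qed

text \<open>
  From here on, submatrices are replaced by sets of column positions: invertibility of the square
  submatrix means that its kernel is trivial.
\<close>

lemma invertible_submatrix_iff_free_cols:
  fixes A :: "complex mat"
  assumes A: "A \<in> carrier_mat r n" and J: "J \<subseteq> {..<n}" and r: "card J = r"
  shows "invertible_mat (submatrix A UNIV J) \<longleftrightarrow> free_cols r (\<lambda>i e. A $$ (i, e)) J"
proof -
  let ?S = "mat r r (\<lambda>(i,j). A $$ (i, pick J j))"
  have fin: "finite J" using J finite_subset by blast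
  have bij: "bij_betw (pick J) {..<r} J" using bij_betw_pick[OF fin] r by simp
  have reindex: "(\<Sum>e\<in>J. z e * A $$ (i, e)) = (\<Sum>j<r. z (pick J j) * A $$ (i, pick J j))" for z i
    by (rule sum.reindex_bij_betw[OF bij, symmetric])
  have mult: "(?S *\<^sub>v v) $ i = (\<Sum>j<r. v $ j * A $$ (i, pick J j))"
    if "v \<in> carrier_vec r" "i < r" for v i
    using that by (simp add: scalar_prod_def mult.commute lessThan_atLeast0)
  have "invertible_mat ?S \<longleftrightarrow> \<not> (\<exists>v. v \<in> carrier_vec r \<and> v \<noteq> 0\<^sub>v r \<and> ?S *\<^sub>v v = 0\<^sub>v r)"
    using invertible_iff_det[of ?S r] det_0_iff_vec_prod_zero_field[of ?S r] by auto
  also have "\<dots> \<longleftrightarrow> free_cols r (\<lambda>i e. A $$ (i, e)) J"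
  proof
    assume *: "\<not> (\<exists>v. v \<in> carrier_vec r \<and> v \<noteq> 0\<^sub>v r \<and> ?S *\<^sub>v v = 0\<^sub>v r)"
    show "free_cols r (\<lambda>i e. A $$ (i, e)) J"
      unfolding free_cols_def
    proof (intro allI impI)
      fix z :: "nat \<Rightarrow> complex"
      assume z: "\<forall>i<r. (\<Sum>e\<in>J. z e * A $$ (i, e)) = 0"
      let ?v = "vec r (\<lambda>j. z (pick J j))"
      have "?S *\<^sub>v ?v = 0\<^sub>v r"
      proof (rule eq_vecI)
        fix i assume "i < dim_vec (0\<^sub>v r)"
        then have "i < r" by simp
        then have "(?S *\<^sub>v ?v) $ i = (\<Sum>j<r. z (pick J j) * A $$ (i, pick J j))"
          by (subst mult) auto
        also have "\<dots> = 0" using z reindex \<open>i < r\<close> by metis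
        finally show "(?S *\<^sub>v ?v) $ i = 0\<^sub>v r $ i" using \<open>i < r\<close> by simp
      qed simp
      with * have "?v = 0\<^sub>v r" using vec_carrier by blast
      then have "\<forall>j<r. z (pick J j) = 0"
        by (metis index_vec index_zero_vec(1))
      then show "\<forall>e\<in>J. z e = 0"
        using bij by (metis bij_betw_iff_bijections lessThan_iff)
    qed
  next
    assume free: "free_cols r (\<lambda>i e. A $$ (i, e)) J"
    have "v = 0\<^sub>v r" if v: "v \<in> carrier_vec r" and Sv: "?S *\<^sub>v v = 0\<^sub>v r" for v
    proof -
      let ?z = "\<lambda>e. v $ (the_inv_into {..<r} (pick J) e)"
      have inj: "inj_on (pick J) {..<r}" using bij by (rule bij_betw_imp_inj_on)
      have zp: "?z (pick J j) = v $ j" if "j < r" for j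
        using the_inv_into_f_f[OF inj] that by simp
      have "(\<Sum>e\<in>J. ?z e * A $$ (i, e)) = 0" if "i < r" for i
        using mult[OF v that] Sv that zp by (simp add: reindex)
      then have "?z e = 0" if "e \<in> J" for e
        using free_colsD[OF free, of ?z e] that by blast
      then have "v $ j = 0" if "j < r" for j
        using zp[OF that] bij_betwE[OF bij] that by force
      then show ?thesis using v by auto
    qed
    then show "\<not> (\<exists>v. v \<in> carrier_vec r \<and> v \<noteq> 0\<^sub>v r \<and> ?S *\<^sub>v v = 0\<^sub>v r)" by blast
  qed
  finally show ?thesis using submatrix_all_rows[OF A J r] by simp
qed

text \<open>
  The same with the left kernel. Duality compares a condition on the columns of one matrix with a
  condition on the rows of another, so both forms are needed.
\<close>

lemma invertible_submatrix_iff_row_kernel: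
  fixes A :: "complex mat"
  assumes A: "A \<in> carrier_mat r n" and J: "J \<subseteq> {..<n}" and r: "card J = r"
  shows "invertible_mat (submatrix A UNIV J) \<longleftrightarrow>
    (\<forall>y. (\<forall>e\<in>J. (\<Sum>i<r. y i * A $$ (i, e)) = 0) \<longrightarrow> (\<forall>i<r. y i = 0))"
proof -
  let ?S = "mat r r (\<lambda>(i,j). A $$ (i, pick J j))"
  let ?T = "mat r r (\<lambda>(j,i). A $$ (i, pick J j))"
  have fin: "finite J" using J finite_subset by blast
  have bij: "bij_betw (pick J) {..<r} J" using bij_betw_pick[OF fin] r by simp
  have T: "transpose_mat ?S = ?T" by (rule eq_matI) auto
  have det: "det ?S = det ?T" using det_transpose[of ?S r] T by simp
  have mult: "(?T *\<^sub>v v) $ j = (\<Sum>i<r. v $ i * A $$ (i, pick J j))"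
    if "v \<in> carrier_vec r" "j < r" for v j
    using that by (simp add: scalar_prod_def mult.commute lessThan_atLeast0)
  have ball: "(\<forall>e\<in>J. P e) \<longleftrightarrow> (\<forall>j<r. P (pick J j))" for P
    using bij by (metis bij_betw_iff_bijections lessThan_iff)
  have "invertible_mat ?S \<longleftrightarrow> \<not> (\<exists>v. v \<in> carrier_vec r \<and> v \<noteq> 0\<^sub>v r \<and> ?T *\<^sub>v v = 0\<^sub>v r)"
    using invertible_iff_det[of ?S r] det_0_iff_vec_prod_zero_field[of ?T r] det by auto
  also have "\<dots> \<longleftrightarrow> (\<forall>y. (\<forall>e\<in>J. (\<Sum>i<r. y i * A $$ (i, e)) = 0) \<longrightarrow> (\<forall>i<r. y i = 0))"
  proof
    assume *: "\<not> (\<exists>v. v \<in> carrier_vec r \<and> v \<noteq> 0\<^sub>v r \<and> ?T *\<^sub>v v = 0\<^sub>v r)"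
    show "\<forall>y. (\<forall>e\<in>J. (\<Sum>i<r. y i * A $$ (i, e)) = 0) \<longrightarrow> (\<forall>i<r. y i = 0)"
    proof (intro allI impI)
      fix y :: "nat \<Rightarrow> complex" and i
      assume y: "\<forall>e\<in>J. (\<Sum>i<r. y i * A $$ (i, e)) = 0" and "i < r"
      have "?T *\<^sub>v vec r y = 0\<^sub>v r"
      proof (rule eq_vecI)
        fix j assume "j < dim_vec (0\<^sub>v r)"
        then have "j < r" by simp
        then show "(?T *\<^sub>v vec r y) $ j = 0\<^sub>v r $ j"
          using y by (subst mult) (auto simp: ball)
      qed simp
      with * have "vec r y = 0\<^sub>v r" using vec_carrier by blast
      then show "y i = 0"
        using \<open>i < r\<close> by (metis index_vec index_zero_vec(1))
    qed
  next
    assume free: "\<forall>y. (\<forall>e\<in>J. (\<Sum>i<r. y i * A $$ (i, e)) = 0) \<longrightarrow> (\<forall>i<r. y i = 0)"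
    have "v = 0\<^sub>v r" if v: "v \<in> carrier_vec r" and Tv: "?T *\<^sub>v v = 0\<^sub>v r" for v
    proof -
      have "\<forall>e\<in>J. (\<Sum>i<r. v $ i * A $$ (i, e)) = 0"
        using mult[OF v] Tv by (simp add: ball)
      then have "\<forall>i<r. v $ i = 0" using free by blast
      then show ?thesis using v by auto
    qed
    then show "\<not> (\<exists>v. v \<in> carrier_vec r \<and> v \<noteq> 0\<^sub>v r \<and> ?T *\<^sub>v v = 0\<^sub>v r)" by blast
  qed
  finally show ?thesis using submatrix_all_rows[OF A J r] by simp
qed

definition bases :: "nat \<Rightarrow> nat \<Rightarrow> (nat \<Rightarrow> nat \<Rightarrow> complex) \<Rightarrow> nat set set" where
  "bases n r a = {J. J \<subseteq> {..<n} \<and> card J = r \<and> free_cols r a J}"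

lemma free_cols_cong:
  assumes "\<And>i e. i < r \<Longrightarrow> e \<in> J \<Longrightarrow> a i e = a' i e"
  shows "free_cols r a J \<longleftrightarrow> free_cols r a' J"
  unfolding free_cols_def using assms by (auto cong: sum.cong)

lemma nrb_matrix_of_bases:
  assumes "card (bases n r a) = b"
  shows "\<exists>A. nrb_matrix n r b A"
proof -
  let ?A = "mat r n (\<lambda>(i,e). a i e)"
  have "{J. J \<subseteq> {..<n} \<and> card J = r \<and> invertible_mat (submatrix ?A UNIV J)} = bases n r a"
    unfolding bases_def
  proof (intro Collect_cong conj_cong refl)
    fix J assume J: "J \<subseteq> {..<n}" "card J = r"
    have "free_cols r (\<lambda>i e. ?A $$ (i, e)) J \<longleftrightarrow> free_cols r a J"
      using J by (intro free_cols_cong) auto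
    then show "invertible_mat (submatrix ?A UNIV J) \<longleftrightarrow> free_cols r a J"
      using invertible_submatrix_iff_free_cols[of ?A r n J] J by simp
  qed
  then have "nrb_matrix n r b ?A"
    using assms by (simp add: nrb_matrix_def)
  then show ?thesis ..
qed

section \<open>Loops and duality\<close>

lemma bases_extend_by_zero_columns:
  assumes "n \<le> m"
  shows "bases m r (\<lambda>i e. if e < n then a i e else 0) = bases n r a" (is "bases m r ?a = _")
proof -
  have "J \<subseteq> {..<n}" if J: "J \<subseteq> {..<m}" and free: "free_cols r ?a J" for J
  proof (rule ccontr)
    assume "\<not> J \<subseteq> {..<n}"
    then obtain e where e: "e \<in> J" "\<not> e < n" by auto
    have fin: "finite J" using J finite_subset by blast
    have "(\<Sum>f\<in>J. (if f = e then 1 else 0) * ?a i f) = 0" for i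
      using e by (intro sum.neutral) auto
    then have "(if e = e then 1 else 0 :: complex) = 0"
      using free_colsD[OF free, of "\<lambda>f. if f = e then 1 else 0"] e(1) by blast
    then show False by simp
  qed
  note loops = this
  have same: "free_cols r ?a J \<longleftrightarrow> free_cols r a J" if "J \<subseteq> {..<n}" for J
    using that by (intro free_cols_cong) auto
  have "J \<in> bases m r ?a \<longleftrightarrow> J \<in> bases n r a" for J
  proof (cases "J \<subseteq> {..<n}")
    case True
    moreover from True have "J \<subseteq> {..<m}" using assms by auto
    ultimately show ?thesis using same[OF True] by (simp add: bases_def)
  next
    case False
    then show ?thesis using loops[of J] unfolding bases_def by blast
  qed
  then show ?thesis by blast
qed

text \<open>
  The coordinates are the entries of the inverse of the basis submatrix times the column.
\<close>

lemma basis_spans_columns: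
  assumes J: "J \<in> bases n r a" and "e < n"
  shows "\<exists>w. \<forall>i<r. a i e = (\<Sum>f\<in>J. w f * a i f)"
proof -
  let ?A = "mat r n (\<lambda>(i,e). a i e)"
  let ?S = "mat r r (\<lambda>(i,j). a i (pick J j))"
  have J': "J \<subseteq> {..<n}" "card J = r" and free: "free_cols r a J"
    using J by (auto simp: bases_def)
  have fin: "finite J" using J' finite_subset by blast
  have bij: "bij_betw (pick J) {..<r} J" using bij_betw_pick[OF fin] J' by simp
  have "free_cols r (\<lambda>i e. ?A $$ (i, e)) J"
    using free J' by (subst free_cols_cong[where a' = a]) auto
  then have "invertible_mat (submatrix ?A UNIV J)"
    using invertible_submatrix_iff_free_cols[of ?A r n J] J' by simp
  also have "submatrix ?A UNIV J = mat r r (\<lambda>(i,j). ?A $$ (i, pick J j))"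
    using submatrix_all_rows[of ?A r n J] J' by simp
  also have "\<dots> = ?S"
    using bij J' by (intro eq_matI) (auto dest!: bij_betwE)
  finally have "det ?S \<noteq> 0"
    using invertible_iff_det[of ?S r] by simp
  then obtain B where B: "B \<in> carrier_mat r r" "?S * B = 1\<^sub>m r"
    using det_non_zero_imp_unit[of ?S r] by (auto simp: Units_def ring_mat_def)
  define c where "c = vec r (\<lambda>i. a i e)"
  have c: "c \<in> carrier_vec r" by (simp add: c_def)
  define v where "v = B *\<^sub>v c"
  have v: "v \<in> carrier_vec r" using B c by (simp add: v_def)
  have "?S *\<^sub>v v = c"
    using B c by (simp add: v_def assoc_mult_mat_vec[symmetric, of _ r r _ r])
  then have eq: "a i e = (\<Sum>j<r. v $ j * a i (pick J j))" if "i < r" for i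
  proof -
    have "a i e = (?S *\<^sub>v v) $ i" using \<open>?S *\<^sub>v v = c\<close> that by (simp add: c_def)
    then show ?thesis
      using that v by (simp add: scalar_prod_def mult.commute lessThan_atLeast0)
  qed
  let ?w = "\<lambda>f. v $ (the_inv_into {..<r} (pick J) f)"
  have "(\<Sum>f\<in>J. ?w f * a i f) = (\<Sum>j<r. v $ j * a i (pick J j))" for i
    using the_inv_into_f_f[OF bij_betw_imp_inj_on[OF bij]]
    by (subst sum.reindex_bij_betw[OF bij, symmetric]) simp
  then show ?thesis using eq by metis
qed

text \<open>
  Let \<open>J0\<close> be a basis. A vector in the kernel of \<open>a\<close> is determined by its entries outside \<open>J0\<close>, and these are
  arbitrary, so the kernel is the row space of a matrix \<open>b\<close> with an identity block outside \<open>J0\<close>. A set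
  \<open>J\<close> of \<open>n - c\<close> columns of \<open>b\<close> fails to be a basis if and only if some nonzero combination of the rows of \<open>b\<close>
  vanishes on \<open>J\<close>. Such a combination is a nonzero kernel vector of \<open>a\<close> supported on the complement of \<open>J\<close>, and it
  exists if and only if the complement is not a basis of \<open>a\<close>.
\<close>

lemma dual_bases:
  assumes "bases n c a \<noteq> {}"
  shows "\<exists>a'. card (bases n (n - c) a') = card (bases n c a)"
proof -
  obtain J0 where J0: "J0 \<in> bases n c a" using assms by blast
  then have J0': "J0 \<subseteq> {..<n}" "card J0 = c" "free_cols c a J0"
    by (auto simp: bases_def)
  have fin0: "finite J0" using J0' finite_subset by blast
  have "c \<le> n" using J0' card_mono[of "{..<n}" J0] by simp
  define r where "r = n - c"
  obtain w where w: "\<And>e i. e < n \<Longrightarrow> i < c \<Longrightarrow> a i e = (\<Sum>f\<in>J0. w e f * a i f)"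
    using basis_spans_columns[OF J0] by metis
  define I where "I = {..<n} - J0"
  have I: "finite I" "card I = r" "J0 \<inter> I = {}" "J0 \<union> I = {..<n}"
    using J0' fin0 by (auto simp: I_def r_def card_Diff_subset)
  define p where "p = pick I"
  have p: "bij_betw p {..<r} I" using bij_betw_pick[OF I(1)] I(2) by (simp add: p_def)
  define b where "b i e = (if e \<in> J0 then - w (p i) e else if e = p i then 1 else 0)" for i e
  \<comment> \<open>the combination of the rows of \<open>b\<close> with coefficients \<open>y\<close>\<close>
  define z where "z y e = (\<Sum>i<r. y i * b i e)" for y e
  have pI: "p j \<in> I" if "j < r" for j using p that by (auto dest: bij_betwE)
  have zp: "z y (p j) = y j" if "j < r" for y j
  proof -
    have "p j \<notin> J0" using pI[OF that] by (simp add: I_def)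
    moreover have "p i = p j \<longleftrightarrow> i = j" if "i < r" for i
      using bij_betw_imp_inj_on[OF p] that \<open>j < r\<close> by (auto dest: inj_onD)
    ultimately have "b i (p j) = (if i = j then 1 else 0)" if "i < r" for i
      using that unfolding b_def by metis
    then have "z y (p j) = (\<Sum>i<r. if i = j then y i else 0)"
      unfolding z_def by (intro sum.cong) auto
    then show ?thesis using that by simp
  qed
  have zker: "(\<Sum>e<n. z y e * a k e) = 0" if k: "k < c" for y k
  proof -
    have "(\<Sum>e<n. z y e * a k e) = (\<Sum>e\<in>J0. z y e * a k e) + (\<Sum>e\<in>I. z y e * a k e)"
      using sum.union_disjoint[OF fin0 I(1) I(3), of "\<lambda>e. z y e * a k e"] I(4) by simp
    also have "(\<Sum>e\<in>I. z y e * a k e) = (\<Sum>j<r. y j * a k (p j))"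
      using zp by (subst sum.reindex_bij_betw[OF p, symmetric]) simp
    also have "(\<Sum>e\<in>J0. z y e * a k e) = (\<Sum>e\<in>J0. \<Sum>i<r. - (y i * (w (p i) e * a k e)))"
    proof (rule sum.cong[OF refl])
      fix e assume "e \<in> J0"
      then have "z y e = (\<Sum>i<r. - (y i * w (p i) e))" by (simp add: z_def b_def)
      then show "z y e * a k e = (\<Sum>i<r. - (y i * (w (p i) e * a k e)))"
        by (simp only: sum_distrib_right mult_minus_left mult.assoc)
    qed
    also have "\<dots> = (\<Sum>i<r. \<Sum>e\<in>J0. - (y i * (w (p i) e * a k e)))"
      by (rule sum.swap)
    also have "\<dots> = - (\<Sum>i<r. y i * (\<Sum>e\<in>J0. w (p i) e * a k e))"
      by (simp only: sum_negf sum_distrib_left)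
    also have "(\<Sum>i<r. y i * (\<Sum>e\<in>J0. w (p i) e * a k e)) = (\<Sum>i<r. y i * a k (p i))"
      using w[OF _ k] pI by (intro sum.cong) (auto simp: I_def)
    finally show ?thesis by simp
  qed
  \<comment> \<open>both sides lie in the kernel and agree outside the basis \<open>J0\<close>, so they agree on \<open>J0\<close> as well\<close>
  have ker: "z (\<lambda>i. x (p i)) e = x e"
    if x: "\<And>k. k < c \<Longrightarrow> (\<Sum>e<n. x e * a k e) = 0" and e: "e < n" for x e
  proof -
    let ?y = "\<lambda>i. x (p i)"
    have onI: "z ?y e = x e" if "e \<in> I" for e
    proof -
      have "e \<in> p ` {..<r}"
        using that by (simp add: bij_betw_imp_surj_on[OF p])
      then obtain j where "j < r" "e = p j" by auto
      then show ?thesis using zp by simp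
    qed
    have "(\<Sum>e\<in>J0. (z ?y e - x e) * a k e) = 0" if k: "k < c" for k
    proof -
      have "0 = (\<Sum>e<n. z ?y e * a k e) - (\<Sum>e<n. x e * a k e)"
        using zker[OF k] x[OF k] by simp
      also have "\<dots> = (\<Sum>e\<in>J0 \<union> I. (z ?y e - x e) * a k e)"
        unfolding I(4) by (simp add: sum_subtractf left_diff_distrib)
      also have "\<dots> = (\<Sum>e\<in>J0. (z ?y e - x e) * a k e) + (\<Sum>e\<in>I. (z ?y e - x e) * a k e)"
        by (rule sum.union_disjoint[OF fin0 I(1) I(3)])
      also have "(\<Sum>e\<in>I. (z ?y e - x e) * a k e) = 0"
        using onI by simp
      finally show ?thesis by simp
    qed
    then have "z ?y e - x e = 0" if "e \<in> J0" for e
      using free_colsD[OF J0'(3), of "\<lambda>e. z ?y e - x e"] that by blast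
    then show ?thesis using onI[of e] e I(4) by (cases "e \<in> J0") auto
  qed
  have dual: "free_cols r b J \<longleftrightarrow> free_cols c a ({..<n} - J)"
    if J: "J \<subseteq> {..<n}" "card J = r" for J
  proof -
    let ?B = "mat r n (\<lambda>(i,e). b i e)" and ?K = "{..<n} - J"
    have sumB: "(\<Sum>i<r. y i * ?B $$ (i, e)) = z y e" if "e < n" for y e
      using that by (simp add: z_def)
    have "free_cols r b J \<longleftrightarrow> free_cols r (\<lambda>i e. ?B $$ (i, e)) J"
      using J by (intro free_cols_cong) auto
    also have "\<dots> \<longleftrightarrow> (\<forall>y. (\<forall>e\<in>J. (\<Sum>i<r. y i * ?B $$ (i, e)) = 0) \<longrightarrow> (\<forall>i<r. y i = 0))"
      using invertible_submatrix_iff_free_cols[of ?B r n J]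
        invertible_submatrix_iff_row_kernel[of ?B r n J] J by simp
    also have "\<dots> \<longleftrightarrow> (\<forall>y. (\<forall>e\<in>J. z y e = 0) \<longrightarrow> (\<forall>i<r. y i = 0))"
    proof -
      have "(\<forall>e\<in>J. (\<Sum>i<r. y i * ?B $$ (i, e)) = 0) \<longleftrightarrow> (\<forall>e\<in>J. z y e = 0)" for y
        using sumB J(1) by (intro ball_cong) auto
      then show ?thesis by simp
    qed
    also have "\<dots> \<longleftrightarrow> free_cols c a ?K"
    proof
      assume *: "\<forall>y. (\<forall>e\<in>J. z y e = 0) \<longrightarrow> (\<forall>i<r. y i = 0)"
      show "free_cols c a ?K"
        unfolding free_cols_def
      proof (intro allI impI ballI)
        fix x e
        assume x: "\<forall>k<c. (\<Sum>e\<in>?K. x e * a k e) = 0" and e: "e \<in> ?K"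
        define x' where "x' = (\<lambda>e. if e \<in> J then 0 else x e)"
        have x': "(\<Sum>e<n. x' e * a k e) = 0" if "k < c" for k
        proof -
          have "(\<Sum>e<n. x' e * a k e) = (\<Sum>e\<in>?K. x' e * a k e)"
            by (rule sum.mono_neutral_right) (auto simp: x'_def)
          also have "\<dots> = (\<Sum>e\<in>?K. x e * a k e)"
            by (rule sum.cong) (auto simp: x'_def)
          finally show ?thesis using x that by simp
        qed
        have zx: "z (\<lambda>i. x' (p i)) e = x' e" if "e < n" for e
          using ker[of x' e] x' that by blast
        then have "\<forall>e\<in>J. z (\<lambda>i. x' (p i)) e = 0"
          using J(1) by (auto simp: x'_def)
        then have "\<forall>i<r. x' (p i) = 0" using * by blast
        then have "z (\<lambda>i. x' (p i)) e = 0" by (simp add: z_def)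
        then show "x e = 0" using zx[of e] e by (simp add: x'_def)
      qed
    next
      assume *: "free_cols c a ?K"
      show "\<forall>y. (\<forall>e\<in>J. z y e = 0) \<longrightarrow> (\<forall>i<r. y i = 0)"
      proof (intro allI impI)
        fix y i assume y: "\<forall>e\<in>J. z y e = 0" and i: "i < r"
        have "(\<Sum>e\<in>?K. z y e * a k e) = 0" if "k < c" for k
        proof -
          have "(\<Sum>e\<in>?K. z y e * a k e) = (\<Sum>e<n. z y e * a k e)"
            using y J(1) by (intro sum.mono_neutral_left) auto
          then show ?thesis using zker[OF that] by simp
        qed
        then have "z y e = 0" if "e \<in> ?K" for e
          using free_colsD[OF *, of "z y"] that by blast
        moreover have "p i < n" using pI[OF i] by (auto simp: I_def)
        ultimately have "z y (p i) = 0" using y by (cases "p i \<in> J") auto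
        then show "y i = 0" using zp[OF i] by simp
      qed
    qed
    finally show ?thesis .
  qed
  have "bases n r b = (\<lambda>K. {..<n} - K) ` bases n c a"
  proof (intro equalityI subsetI)
    fix J assume "J \<in> bases n r b"
    then have J: "J \<subseteq> {..<n}" "card J = r" "free_cols r b J" by (auto simp: bases_def)
    then have "card ({..<n} - J) = c"
      using \<open>c \<le> n\<close> by (subst card_Diff_subset) (auto simp: r_def finite_subset)
    then have "{..<n} - J \<in> bases n c a"
      using dual J by (auto simp: bases_def)
    moreover have "J = {..<n} - ({..<n} - J)" using J(1) by auto
    ultimately show "J \<in> (\<lambda>K. {..<n} - K) ` bases n c a" by blast
  next
    fix J assume "J \<in> (\<lambda>K. {..<n} - K) ` bases n c a"
    then obtain K where J: "J = {..<n} - K" and K: "K \<in> bases n c a" by blast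
    have K': "K \<subseteq> {..<n}" "card K = c" using K by (auto simp: bases_def)
    have "card J = r"
      using K' by (simp add: J card_Diff_subset finite_subset[OF K'(1)] r_def)
    moreover have "{..<n} - J = K" using K' J by auto
    ultimately show "J \<in> bases n r b"
      using dual[of J] K by (auto simp: bases_def J)
  qed
  moreover have "inj_on (\<lambda>K. {..<n} - K) (bases n c a)"
    by (rule inj_onI) (auto simp: bases_def)
  ultimately have "card (bases n r b) = card (bases n c a)"
    by (simp add: card_image)
  then show ?thesis unfolding r_def by blast
qed

text \<open>
  By \<open>nrb_matrix_of_bases\<close>, a realizable triple \<open>(n, r, b)\<close> is one for which an \<open>(n, r, b)\<close>-matrix exists.
\<close>

definition realizable :: "nat \<Rightarrow> nat \<Rightarrow> nat \<Rightarrow> bool" where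
  "realizable n r b \<longleftrightarrow> (\<exists>a. card (bases n r a) = b)"

lemma realizable_add_loops:
  assumes "realizable n r b" and "n \<le> m"
  shows "realizable m r b"
  using assms bases_extend_by_zero_columns unfolding realizable_def by metis

lemma realizable_dual:
  assumes "realizable n c b" and "0 < b"
  shows "realizable n (n - c) b"
proof -
  obtain a where a: "card (bases n c a) = b" using assms unfolding realizable_def by blast
  then have "bases n c a \<noteq> {}" using assms(2) by auto
  from dual_bases[OF this] show ?thesis using a unfolding realizable_def by simp
qed

lemma realizable_rank_0: "realizable n 0 1"
proof -
  have "bases n 0 (\<lambda>_ _. 0) = {{}}"
    by (auto simp: bases_def free_cols_def finite_subset[of _ "{..<n}"])
  then show ?thesis unfolding realizable_def by (intro exI[of _ "\<lambda>_ _. 0"]) simp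
qed

lemma realizable_rank_1: "b \<le> n \<Longrightarrow> realizable n 1 b"
proof (rule realizable_add_loops)
  have "bases b 1 (\<lambda>_ _. 1) = {J. J \<subseteq> {..<b} \<and> card J = 1}"
    by (auto simp: bases_def free_cols_def card_1_singleton_iff)
  then have "card (bases b 1 (\<lambda>_ _. 1)) = b" by (simp add: n_subsets)
  then show "realizable b 1 b" unfolding realizable_def by blast
qed

section \<open>Counting sets that meet a new class in at most one element\<close>

text \<open>
  Every count below grows in the same way: the new elements \<open>N, ..., N + m - 1\<close> are parallel, so an
  independent set contains at most one of them, and the rest of the set consists of old elements.
\<close>

lemma card_subsets_add_class:
  assumes new: "\<And>A y. A \<subseteq> {..<N} \<Longrightarrow> card A = k \<Longrightarrow> y \<in> {N..<N+m} \<Longrightarrow> \<Phi> (insert y A) \<longleftrightarrow> \<Psi> A"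
    and one: "\<And>J y y'. \<Phi> J \<Longrightarrow> y \<in> J \<Longrightarrow> y' \<in> J \<Longrightarrow> y \<in> {N..<N+m} \<Longrightarrow> y' \<in> {N..<N+m} \<Longrightarrow> y = y'"
  shows "card {J. J \<subseteq> {..<N+m} \<and> card J = Suc k \<and> \<Phi> J} =
    card {J. J \<subseteq> {..<N} \<and> card J = Suc k \<and> \<Phi> J} + m * card {A. A \<subseteq> {..<N} \<and> card A = k \<and> \<Psi> A}"
    (is "card ?L = card ?O + m * card ?A")
proof -
  let ?Y = "{N..<N+m}"
  let ?ins = "\<lambda>(A, y). insert y A"
  have finO: "finite ?O" and finA: "finite ?A"
    by (rule finite_subset[of _ "Pow {..<N}"], auto)+
  have "?L = ?O \<union> ?ins ` (?A \<times> ?Y)"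
  proof (intro equalityI subsetI)
    fix J assume J: "J \<in> ?L"
    then have fin: "finite J" using finite_subset by blast
    show "J \<in> ?O \<union> ?ins ` (?A \<times> ?Y)"
    proof (cases "J \<subseteq> {..<N}")
      case True
      then show ?thesis using J by simp
    next
      case False
      then obtain y where y: "y \<in> J" "y \<in> ?Y" using J by fastforce
      have A: "J - {y} \<subseteq> {..<N}"
      proof
        fix e assume e: "e \<in> J - {y}"
        then have "e \<notin> ?Y" using one[of J e y] J y by blast
        then show "e \<in> {..<N}" using e J by fastforce
      qed
      moreover have "card (J - {y}) = k" using J y fin by simp
      moreover have "\<Psi> (J - {y})"
        using new[OF A \<open>card (J - {y}) = k\<close> y(2)] J y(1) by (simp add: insert_absorb)
      ultimately have "(J - {y}, y) \<in> ?A \<times> ?Y" using y by blast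
      moreover have "J = ?ins (J - {y}, y)" using y by auto
      ultimately show ?thesis by blast
    qed
  next
    fix J assume "J \<in> ?O \<union> ?ins ` (?A \<times> ?Y)"
    then show "J \<in> ?L"
    proof
      assume "J \<in> ?O"
      then show ?thesis by auto
    next
      assume "J \<in> ?ins ` (?A \<times> ?Y)"
      then obtain A y where J: "J = insert y A" and A: "A \<subseteq> {..<N}" "card A = k" "\<Psi> A" and y: "y \<in> ?Y"
        by auto
      have "finite A" "y \<notin> A" using A(1) y finite_subset by auto
      then have "card J = Suc k" using J A(2) by simp
      moreover have "\<Phi> J" using new[OF A(1,2) y] A(3) J by simp
      ultimately show ?thesis using J A(1) y by auto
    qed
  qed
  moreover have "?O \<inter> ?ins ` (?A \<times> ?Y) = {}" by auto
  moreover have "inj_on ?ins (?A \<times> ?Y)"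
  proof (rule inj_onI)
    fix u v assume u: "u \<in> ?A \<times> ?Y" and v: "v \<in> ?A \<times> ?Y" and eq: "?ins u = ?ins v"
    obtain A y B z where uv: "u = (A, y)" "v = (B, z)" by fastforce
    have AB: "A \<subseteq> {..<N}" "B \<subseteq> {..<N}" "N \<le> y" "N \<le> z" using u v uv by auto
    have ins: "insert y A = insert z B" using eq uv by simp
    have "y = z" using ins AB by (metis insertE insertI1 lessThan_iff not_less subsetD)
    moreover have "y \<notin> A" "z \<notin> B" using AB by auto
    ultimately show "u = v" using ins uv by (metis insert_ident)
  qed
  ultimately have "card ?L = card ?O + card (?A \<times> ?Y)"
    using finO finA by (simp add: card_Un_disjoint card_image)
  then show ?thesis by (simp add: card_cartesian_product)
qed

section \<open>Points in general position on vertical lines\<close>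

lemma all_less_3: "(\<forall>i<3. Q i) \<longleftrightarrow> Q 0 \<and> Q 1 \<and> Q (2::nat)"
  by (auto simp: less_Suc_eq numeral_3_eq_3 numeral_2_eq_2)

text \<open>
  Twice the signed area of a triangle, which is the determinant of the matrix with columns \<open>(1, p)\<close>,
  \<open>(1, q)\<close> and \<open>(1, s)\<close>.
\<close>

definition area :: "complex \<times> complex \<Rightarrow> complex \<times> complex \<Rightarrow> complex \<times> complex \<Rightarrow> complex" where
  "area p q s = (fst q - fst p) * (snd s - snd p) - (fst s - fst p) * (snd q - snd p)"

text \<open>
  This is Cramer's rule: an affine relation between three points expresses a linear relation between two
  difference vectors, whose determinant annihilates the coefficients.
\<close>

lemma affine_relation:
  fixes u v w :: complex
  assumes "u + v + w = 0" and "u * x1 + v * x2 + w * x3 = 0" and "u * y1 + v * y2 + w * y3 = 0"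
  shows "v * ((x2 - x1) * (y3 - y1) - (x3 - x1) * (y2 - y1)) = 0"
    and "w * ((x2 - x1) * (y3 - y1) - (x3 - x1) * (y2 - y1)) = 0"
proof -
  have "v * (x2 - x1) + w * (x3 - x1) = (u * x1 + v * x2 + w * x3) - (u + v + w) * x1"
    by (simp add: algebra_simps)
  then have x: "v * (x2 - x1) + w * (x3 - x1) = 0" using assms by simp
  have "v * (y2 - y1) + w * (y3 - y1) = (u * y1 + v * y2 + w * y3) - (u + v + w) * y1"
    by (simp add: algebra_simps)
  then have y: "v * (y2 - y1) + w * (y3 - y1) = 0" using assms by simp
  have "v * ((x2 - x1) * (y3 - y1) - (x3 - x1) * (y2 - y1)) =
      (v * (x2 - x1) + w * (x3 - x1)) * (y3 - y1) - (v * (y2 - y1) + w * (y3 - y1)) * (x3 - x1)"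
    by (simp add: algebra_simps)
  then show "v * ((x2 - x1) * (y3 - y1) - (x3 - x1) * (y2 - y1)) = 0" using x y by simp
  have "w * ((x2 - x1) * (y3 - y1) - (x3 - x1) * (y2 - y1)) =
      (v * (y2 - y1) + w * (y3 - y1)) * (x2 - x1) - (v * (x2 - x1) + w * (x3 - x1)) * (y2 - y1)"
    by (simp add: algebra_simps)
  then show "w * ((x2 - x1) * (y3 - y1) - (x3 - x1) * (y2 - y1)) = 0" using x y by simp
qed

text \<open>
  For collinear points the differences of the first coordinates are the coefficients of a relation. If they
  all vanish, the differences of the second coordinates serve; if these vanish too, the points coincide.
\<close>

lemma free_cols_affine_iff:
  assumes distinct: "e \<noteq> f" "e \<noteq> g" "f \<noteq> g"
    and a0: "\<And>i. i \<in> {e, f, g} \<Longrightarrow> a 0 i = 1"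
    and a1: "\<And>i. i \<in> {e, f, g} \<Longrightarrow> a 1 i = fst (p i)"
    and a2: "\<And>i. i \<in> {e, f, g} \<Longrightarrow> a 2 i = snd (p i)"
  shows "free_cols 3 a {e, f, g} \<longleftrightarrow> area (p e) (p f) (p g) \<noteq> 0"
proof -
  obtain x1 y1 where e: "p e = (x1, y1)" by fastforce
  obtain x2 y2 where f: "p f = (x2, y2)" by fastforce
  obtain x3 y3 where g: "p g = (x3, y3)" by fastforce
  define D where "D = (x2 - x1) * (y3 - y1) - (x3 - x1) * (y2 - y1)"
  have free: "free_cols 3 a {e, f, g} \<longleftrightarrow>
      (\<forall>z. z e + z f + z g = 0 \<and> z e * x1 + z f * x2 + z g * x3 = 0 \<and> z e * y1 + z f * y2 + z g * y3 = 0
        \<longrightarrow> z e = 0 \<and> z f = 0 \<and> z g = 0)"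
    unfolding free_cols_def all_less_3 using distinct a0 a1 a2
    by (simp add: e f g add.assoc)
  have "free_cols 3 a {e, f, g} \<longleftrightarrow> D \<noteq> 0"
  proof
    assume D: "D \<noteq> 0"
    show "free_cols 3 a {e, f, g}"
      unfolding free
    proof (intro allI impI)
      fix z :: "nat \<Rightarrow> complex"
      assume z: "z e + z f + z g = 0 \<and> z e * x1 + z f * x2 + z g * x3 = 0 \<and> z e * y1 + z f * y2 + z g * y3 = 0"
      then have z1: "z e + z f + z g = 0" and z2: "z e * x1 + z f * x2 + z g * x3 = 0"
        and z3: "z e * y1 + z f * y2 + z g * y3 = 0" by auto
      have "z f * D = 0" "z g * D = 0"
        unfolding D_def by (rule affine_relation[OF z1 z2 z3])+
      then show "z e = 0 \<and> z f = 0 \<and> z g = 0" using D z1 by simp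
    qed
  next
    assume "free_cols 3 a {e, f, g}"
    note * = this[unfolded free]
    show "D \<noteq> 0"
    proof
      assume D: "D = 0"
      have dep: "u = 0 \<and> v = 0 \<and> w = 0"
        if "u + v + w = 0" "u * x1 + v * x2 + w * x3 = 0" "u * y1 + v * y2 + w * y3 = 0" for u v w
        using spec[OF *, of "\<lambda>i. if i = e then u else if i = f then v else w"] that distinct by auto
      have "(x2 - x3) * y1 + (x3 - x1) * y2 + (x1 - x2) * y3 = - D"
        by (simp add: D_def algebra_simps)
      then have "x2 - x3 = 0 \<and> x3 - x1 = 0 \<and> x1 - x2 = 0"
        by (intro dep) (simp_all add: D algebra_simps)
      then have "x1 - x2 = 0" "x3 - x1 = 0" by blast+
      then have x: "x2 = x1" "x3 = x1" by simp_all
      have "y2 - y3 = 0 \<and> y3 - y1 = 0 \<and> y1 - y2 = 0"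
        by (intro dep) (simp_all add: x algebra_simps)
      then have "y1 - y2 = 0" "y3 - y1 = 0" by blast+
      then have y: "y2 = y1" "y3 = y1" by simp_all
      have "(1::complex) = 0 \<and> - 1 = (0::complex) \<and> (0::complex) = 0"
        by (rule dep) (simp_all add: x y)
      then show False by simp
    qed
  qed
  then show ?thesis by (simp add: area_def D_def e f g)
qed

text \<open>
  The column \<open>(0, 0, 1)\<close> is the point at infinity of the vertical lines, so it is collinear with two affine points
  if and only if these have the same first coordinate.
\<close>

lemma free_cols_vertical_iff:
  assumes distinct: "e \<noteq> f" "e \<noteq> g" "f \<noteq> g"
    and e: "a 0 e = 0" "a 1 e = 0" "a 2 e = 1" and fg: "a 0 f = 1" "a 0 g = 1"
  shows "free_cols 3 a {e, f, g} \<longleftrightarrow> a 1 f \<noteq> a 1 g"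
proof -
  have free: "free_cols 3 a {e, f, g} \<longleftrightarrow>
      (\<forall>z. z f + z g = 0 \<and> z f * a 1 f + z g * a 1 g = 0 \<and> z e + z f * a 2 f + z g * a 2 g = 0
        \<longrightarrow> z e = 0 \<and> z f = 0 \<and> z g = 0)"
    unfolding free_cols_def all_less_3 using distinct e fg by (simp add: add.assoc)
  show ?thesis
  proof
    assume "free_cols 3 a {e, f, g}"
    note * = spec[OF this[unfolded free], of "\<lambda>i. if i = e then a 2 g - a 2 f else if i = f then 1 else - 1"]
    show "a 1 f \<noteq> a 1 g" using * distinct by auto
  next
    assume ne: "a 1 f \<noteq> a 1 g"
    show "free_cols 3 a {e, f, g}"
      unfolding free
    proof (intro allI impI)
      fix z :: "nat \<Rightarrow> complex"
      assume z: "z f + z g = 0 \<and> z f * a 1 f + z g * a 1 g = 0 \<and> z e + z f * a 2 f + z g * a 2 g = 0"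
      then have z1: "z f + z g = 0" and z2: "z f * a 1 f + z g * a 1 g = 0" by auto
      have "z g = - z f" using z1 by (simp add: add_eq_0_iff)
      with z2 have "z f * (a 1 f - a 1 g) = 0" by (simp add: right_diff_distrib)
      then show "z e = 0 \<and> z f = 0 \<and> z g = 0" using z ne by auto
    qed
  qed
qed

text \<open>
  Points with prescribed first coordinates can be placed so that collinearity occurs only on vertical lines. The
  heights are chosen one after the other. A new height has to avoid the earlier heights and the heights at which
  the vertical line through the new point meets the lines through two earlier points; these are
  finitely many values.
\<close>

lemma generic_heights:
  fixes x :: "nat \<Rightarrow> complex"
  shows "\<exists>y. inj_on y {..<q} \<and>
    (\<forall>a<q. \<forall>b<q. \<forall>c<q. a \<noteq> b \<longrightarrow> a \<noteq> c \<longrightarrow> b \<noteq> c \<longrightarrow> \<not> (x a = x b \<and> x a = x c) \<longrightarrow>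
      area (x a, y a) (x b, y b) (x c, y c) \<noteq> 0)"
proof (induction q)
  case 0
  show ?case by simp
next
  case (Suc q)
  then obtain y where inj: "inj_on y {..<q}"
    and gen: "\<And>a b c. a < q \<Longrightarrow> b < q \<Longrightarrow> c < q \<Longrightarrow> a \<noteq> b \<Longrightarrow> a \<noteq> c \<Longrightarrow> b \<noteq> c \<Longrightarrow>
      \<not> (x a = x b \<and> x a = x c) \<Longrightarrow> area (x a, y a) (x b, y b) (x c, y c) \<noteq> 0"
    by blast
  let ?bad = "y ` {..<q} \<union> (\<lambda>(a,b). y a + (x q - x a) * (y b - y a) / (x b - x a)) ` ({..<q} \<times> {..<q})"
  have "finite ?bad" by simp
  then obtain t where t: "t \<notin> ?bad"
    using ex_new_if_finite infinite_UNIV_char_0 by blast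
  have new: "area (x a, y a) (x b, y b) (x q, t) \<noteq> 0"
    if ab: "a < q" "b < q" "a \<noteq> b" and ne: "\<not> (x a = x b \<and> x a = x q)" for a b
  proof (cases "x a = x b")
    case True
    moreover have "y a \<noteq> y b" using inj ab by (auto dest: inj_onD)
    ultimately show ?thesis using ne by (auto simp: area_def)
  next
    case False
    have "t \<noteq> y a + (x q - x a) * (y b - y a) / (x b - x a)" using t ab by auto
    then show ?thesis using False by (auto simp: area_def field_simps)
  qed
  \<comment> \<open>the area is alternating, so the new point may be taken to be the last of the three\<close>
  have swap: "area p r s = area r s p" for p r s
    by (simp_all add: area_def algebra_simps)
  let ?y = "y(q := t)"
  have "area (x a, ?y a) (x b, ?y b) (x c, ?y c) \<noteq> 0"
    if abc: "a < Suc q" "b < Suc q" "c < Suc q" "a \<noteq> b" "a \<noteq> c" "b \<noteq> c" "\<not> (x a = x b \<and> x a = x c)" for a b c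
  proof -
    consider "a = q" | "b = q" | "c = q" | "a < q" "b < q" "c < q"
      using abc(1-3) by linarith
    then show ?thesis
    proof cases
      case 1
      then have "area (x b, y b) (x c, y c) (x q, t) \<noteq> 0" using abc by (intro new) auto
      then show ?thesis using 1 abc by (subst swap) auto
    next
      case 2
      then have "area (x c, y c) (x a, y a) (x q, t) \<noteq> 0" using abc by (intro new) auto
      then show ?thesis using 2 abc by (subst swap, subst swap) auto
    next
      case 3
      then have "area (x a, y a) (x b, y b) (x q, t) \<noteq> 0" using abc by (intro new) auto
      then show ?thesis using 3 abc by auto
    next
      case 4
      then show ?thesis using gen abc by auto
    qed
  qed
  moreover have "inj_on ?y {..<Suc q}"
    using inj t by (auto simp: inj_on_def less_Suc_eq)
  ultimately show ?case by blast
qed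

section \<open>Arrangements of lines through a common point\<close>

text \<open>
  The elements \<open>e\<close> with \<open>cls e = 0\<close> are those at the apex, which lies on every line.
\<close>

definition on_line :: "(nat \<Rightarrow> nat) \<Rightarrow> (nat \<Rightarrow> nat) \<Rightarrow> nat \<Rightarrow> nat set \<Rightarrow> bool" where
  "on_line cls lin l J \<longleftrightarrow> (\<forall>e\<in>J. cls e = 0 \<or> lin (cls e) = l)"

text \<open>
  There are \<open>N\<close> elements. Element \<open>0\<close> is the apex, the function \<open>cls\<close> assigns to every element its class of parallel elements,
  and \<open>lin\<close> assigns to every class other than that of the apex its line through the apex. A triple is a basis
  if its classes are distinct and it is not contained in a line. The number of bases is \<open>b\<close>, and \<open>P\<close> is the number of independent pairs.
  The line \<open>l\<close> is the one to which classes are currently added. The numbers \<open>g\<close> and \<open>h\<close> count the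
  elements and the independent pairs outside \<open>l\<close>, because these are completed to independent pairs that are not
  on \<open>l\<close>, and to bases, by a new element on \<open>l\<close>.
\<close>

definition arrangement :: "nat \<Rightarrow> nat \<Rightarrow> nat \<Rightarrow> nat \<Rightarrow> nat \<Rightarrow> bool" where
  "arrangement N P g h b \<longleftrightarrow> (\<exists>q l cls lin.
     0 < N \<and> (\<forall>e<N. cls e < q \<and> (cls e = 0 \<longleftrightarrow> e = 0)) \<and> (\<forall>c<q. lin c \<le> l) \<and>
     card {J. J \<subseteq> {..<N} \<and> card J = 2 \<and> inj_on cls J} = P \<and>
     card {J. J \<subseteq> {..<N} \<and> card J = 1 \<and> \<not> on_line cls lin l J} = g \<and>
     card {J. J \<subseteq> {..<N} \<and> card J = 2 \<and> inj_on cls J \<and> \<not> on_line cls lin l J} = h \<and>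
     card {J. J \<subseteq> {..<N} \<and> card J = 3 \<and> inj_on cls J \<and> (\<forall>l'. \<not> on_line cls lin l' J)} = b)"

lemma arrangement_start: "arrangement 1 0 0 0 0"
proof -
  have none: "card {J :: nat set. J \<subseteq> {..<1} \<and> card J = k \<and> Q J} = 0" if "2 \<le> k" for k Q
  proof -
    have "\<not> (J \<subseteq> {..<1} \<and> card J = k \<and> Q J)" for J :: "nat set"
      using card_mono[of "{..<1::nat}" J] that by auto
    then show ?thesis by simp
  qed
  have off: "card {J :: nat set. J \<subseteq> {..<1} \<and> card J = 1 \<and> \<not> on_line (\<lambda>_. 0) (\<lambda>_. 0) 0 J} = 0"
    by (simp add: on_line_def)
  show ?thesis
    unfolding arrangement_def
    by (rule exI[of _ 1], rule exI[of _ 0], rule exI[of _ "\<lambda>_. 0"], rule exI[of _ "\<lambda>_. 0"],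
        intro conjI none off) auto
qed

text \<open>
  On a fresh line there is only the apex, so every other element and every independent pair lies outside it.
\<close>

lemma arrangement_new_line:
  assumes "arrangement N P g h b"
  shows "arrangement N P (N - 1) P b"
proof -
  obtain q l cls lin where arr: "0 < N" "\<forall>e<N. cls e < q \<and> (cls e = 0 \<longleftrightarrow> e = 0)" "\<forall>c<q. lin c \<le> l"
     "card {J. J \<subseteq> {..<N} \<and> card J = 2 \<and> inj_on cls J} = P"
     "card {J. J \<subseteq> {..<N} \<and> card J = 3 \<and> inj_on cls J \<and> (\<forall>l'. \<not> on_line cls lin l' J)} = b"
    using assms unfolding arrangement_def by blast
  have off: "on_line cls lin (Suc l) J \<longleftrightarrow> J = {} \<or> J = {0}" if "J \<subseteq> {..<N}" for J
  proof -
    have "cls e = 0 \<or> lin (cls e) = Suc l \<longleftrightarrow> e = 0" if "e \<in> J" for e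
      using arr(2,3) that \<open>J \<subseteq> {..<N}\<close> by (metis Suc_n_not_le_n lessThan_iff subsetD)
    then show ?thesis by (auto simp: on_line_def)
  qed
  have "{J. J \<subseteq> {..<N} \<and> card J = 1 \<and> \<not> on_line cls lin (Suc l) J} = (\<lambda>e. {e}) ` {1..<N}"
  proof (intro equalityI subsetI)
    fix J assume "J \<in> {J. J \<subseteq> {..<N} \<and> card J = 1 \<and> \<not> on_line cls lin (Suc l) J}"
    then obtain e where "J = {e}" "e < N" "e \<noteq> 0"
      using off[of J] by (auto simp: card_1_singleton_iff)
    then show "J \<in> (\<lambda>e. {e}) ` {1..<N}" by auto
  next
    fix J assume "J \<in> (\<lambda>e. {e}) ` {1..<N}"
    then show "J \<in> {J. J \<subseteq> {..<N} \<and> card J = 1 \<and> \<not> on_line cls lin (Suc l) J}"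
      using off[of J] by auto
  qed
  then have "card {J. J \<subseteq> {..<N} \<and> card J = 1 \<and> \<not> on_line cls lin (Suc l) J} = N - 1"
    by (simp add: card_image)
  moreover have "{J. J \<subseteq> {..<N} \<and> card J = 2 \<and> inj_on cls J \<and> \<not> on_line cls lin (Suc l) J}
      = {J. J \<subseteq> {..<N} \<and> card J = 2 \<and> inj_on cls J}"
    using off by auto
  ultimately show ?thesis
    unfolding arrangement_def using arr
    by (intro exI[of _ q] exI[of _ "Suc l"] exI[of _ cls] exI[of _ lin]) (simp add: le_SucI)
qed

text \<open>
  A new element on the current line forms an independent pair with every old element, an independent pair off the line with
  every old element off the line, and a basis with every independent pair off the line.
\<close>

lemma arrangement_add_class:
  assumes "arrangement N P g h b"
  shows "arrangement (N + m) (P + m * N) g (h + m * g) (b + m * h)"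
proof -
  obtain q l cls lin where N: "0 < N" and cls: "\<forall>e<N. cls e < q \<and> (cls e = 0 \<longleftrightarrow> e = 0)"
     and lin: "\<forall>c<q. lin c \<le> l"
     and P: "card {J. J \<subseteq> {..<N} \<and> card J = 2 \<and> inj_on cls J} = P"
     and g: "card {J. J \<subseteq> {..<N} \<and> card J = 1 \<and> \<not> on_line cls lin l J} = g"
     and h: "card {J. J \<subseteq> {..<N} \<and> card J = 2 \<and> inj_on cls J \<and> \<not> on_line cls lin l J} = h"
     and b: "card {J. J \<subseteq> {..<N} \<and> card J = 3 \<and> inj_on cls J \<and> (\<forall>l'. \<not> on_line cls lin l' J)} = b"
    using assms unfolding arrangement_def by blast
  have q: "0 < q" using cls N by auto
  define cls' where "cls' e = (if e < N then cls e else q)" for e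
  define lin' where "lin' = lin(q := l)"
  have inj_old: "inj_on cls' A \<longleftrightarrow> inj_on cls A" if "A \<subseteq> {..<N}" for A
    using that by (intro inj_on_cong) (auto simp: cls'_def)
  have line_old: "on_line cls' lin' l' A \<longleftrightarrow> on_line cls lin l' A" if "A \<subseteq> {..<N}" for A l'
    unfolding on_line_def using that cls by (intro ball_cong) (auto simp: cls'_def lin'_def)
  have inj_new: "inj_on cls' (insert y A) \<longleftrightarrow> inj_on cls A" if "A \<subseteq> {..<N}" "y \<in> {N..<N+m}" for A y
  proof -
    have "cls' y \<notin> cls' ` (A - {y})" using that cls by (force simp: cls'_def)
    moreover have "y \<notin> A" using that by auto
    ultimately show ?thesis using inj_old[OF that(1)] by (simp add: inj_on_insert)
  qed
  have line_new: "on_line cls' lin' l' (insert y A) \<longleftrightarrow> l' = l \<and> on_line cls lin l A"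
    if "A \<subseteq> {..<N}" "y \<in> {N..<N+m}" for A y l'
    using that q line_old[OF that(1)] by (auto simp: on_line_def cls'_def lin'_def)
  have one: "y = y'"
    if "inj_on cls' J" "y \<in> J" "y' \<in> J" "y \<in> {N..<N+m}" "y' \<in> {N..<N+m}" for J y y'
    using that by (auto simp: inj_on_def cls'_def)
  have old: "{J. J \<subseteq> {..<N} \<and> card J = k \<and> \<Phi> J} = {J. J \<subseteq> {..<N} \<and> card J = k \<and> \<Psi> J}"
    if "\<And>J. J \<subseteq> {..<N} \<Longrightarrow> \<Phi> J \<longleftrightarrow> \<Psi> J" for k \<Phi> \<Psi>
    using that by blast
  have singles: "{J. J \<subseteq> {..<N} \<and> card J = 1 \<and> inj_on cls J \<and> Q J} = {J. J \<subseteq> {..<N} \<and> card J = 1 \<and> Q J}" for Q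
    by (auto simp: card_1_singleton_iff)
  have "card {J. J \<subseteq> {..<N} \<and> card J = 1} = N" by (simp add: n_subsets)
  then have "card {J. J \<subseteq> {..<N} \<and> card J = 1 \<and> inj_on cls J} = N"
    using singles[of "\<lambda>_. True"] by simp
  then have P': "card {J. J \<subseteq> {..<N+m} \<and> card J = 2 \<and> inj_on cls' J} = P + m * N"
    using card_subsets_add_class[of N 1 m "inj_on cls'" "inj_on cls"] inj_new one
      old[of "inj_on cls'" "inj_on cls", OF inj_old] P
    by (simp add: numeral_2_eq_2)
  have g': "card {J. J \<subseteq> {..<N+m} \<and> card J = 1 \<and> \<not> on_line cls' lin' l J} = g"
  proof -
    have "J \<subseteq> {..<N+m} \<and> card J = 1 \<and> \<not> on_line cls' lin' l J \<longleftrightarrow>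
        J \<subseteq> {..<N} \<and> card J = 1 \<and> \<not> on_line cls lin l J" for J
    proof (cases "J \<subseteq> {..<N}")
      case True
      then have "J \<subseteq> {..<N+m}" by auto
      then show ?thesis using line_old[OF True] True by simp
    next
      case False
      have "on_line cls' lin' l J" if "card J = 1"
        using that False by (auto simp: card_1_singleton_iff on_line_def cls'_def lin'_def)
      then show ?thesis using False by blast
    qed
    then show ?thesis using g by simp
  qed
  have "card {J. J \<subseteq> {..<N+m} \<and> card J = Suc 1 \<and> inj_on cls' J \<and> \<not> on_line cls' lin' l J} =
      card {J. J \<subseteq> {..<N} \<and> card J = Suc 1 \<and> inj_on cls' J \<and> \<not> on_line cls' lin' l J}
      + m * card {J. J \<subseteq> {..<N} \<and> card J = 1 \<and> inj_on cls J \<and> \<not> on_line cls lin l J}"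
  proof (rule card_subsets_add_class)
    show "inj_on cls' (insert y A) \<and> \<not> on_line cls' lin' l (insert y A) \<longleftrightarrow>
        inj_on cls A \<and> \<not> on_line cls lin l A" if "A \<subseteq> {..<N}" "y \<in> {N..<N+m}" for A y
      using inj_new[OF that] line_new[OF that] by simp
  qed (use one in blast)
  then have h': "card {J. J \<subseteq> {..<N+m} \<and> card J = 2 \<and> inj_on cls' J \<and> \<not> on_line cls' lin' l J} = h + m * g"
    unfolding Suc_1 singles g
    using old[of "\<lambda>J. inj_on cls' J \<and> \<not> on_line cls' lin' l J" "\<lambda>J. inj_on cls J \<and> \<not> on_line cls lin l J" 2]
      inj_old line_old h by simp
  have "card {J. J \<subseteq> {..<N+m} \<and> card J = Suc 2 \<and> inj_on cls' J \<and> (\<forall>l'. \<not> on_line cls' lin' l' J)} =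
      card {J. J \<subseteq> {..<N} \<and> card J = Suc 2 \<and> inj_on cls' J \<and> (\<forall>l'. \<not> on_line cls' lin' l' J)}
      + m * card {J. J \<subseteq> {..<N} \<and> card J = 2 \<and> inj_on cls J \<and> \<not> on_line cls lin l J}"
  proof (rule card_subsets_add_class)
    show "inj_on cls' (insert y A) \<and> (\<forall>l'. \<not> on_line cls' lin' l' (insert y A)) \<longleftrightarrow>
        inj_on cls A \<and> \<not> on_line cls lin l A" if "A \<subseteq> {..<N}" "y \<in> {N..<N+m}" for A y
      using inj_new[OF that] line_new[OF that] by simp
  qed (use one in blast)
  moreover have "Suc 2 = 3" by simp
  ultimately have b': "card {J. J \<subseteq> {..<N+m} \<and> card J = 3 \<and> inj_on cls' J \<and> (\<forall>l'. \<not> on_line cls' lin' l' J)} = b + m * h"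
    using old[of "\<lambda>J. inj_on cls' J \<and> (\<forall>l'. \<not> on_line cls' lin' l' J)"
        "\<lambda>J. inj_on cls J \<and> (\<forall>l'. \<not> on_line cls lin l' J)" 3]
      inj_old line_old h b by simp
  have "\<forall>e<N+m. cls' e < Suc q \<and> (cls' e = 0 \<longleftrightarrow> e = 0)"
    using cls N q by (auto simp: cls'_def less_Suc_eq)
  moreover have "\<forall>c<Suc q. lin' c \<le> l" using lin by (auto simp: lin'_def less_Suc_eq)
  ultimately show ?thesis
    unfolding arrangement_def using N P' g' h' b'
    by (intro exI[of _ "Suc q"] exI[of _ l] exI[of _ cls'] exI[of _ lin']) simp
qed

text \<open>
  The apex is placed at the point at infinity of the vertical lines and the lines become distinct vertical
  lines.
\<close>

lemma arrangement_realizable: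
  assumes "arrangement N P g h b"
  shows "\<exists>a. card (bases N 3 a) = b"
proof -
  obtain q cls lin where N: "0 < N" and cls: "\<forall>e<N. cls e < q \<and> (cls e = 0 \<longleftrightarrow> e = 0)"
     and b: "card {J. J \<subseteq> {..<N} \<and> card J = 3 \<and> inj_on cls J \<and> (\<forall>l'. \<not> on_line cls lin l' J)} = b"
    using assms unfolding arrangement_def by blast
  define x :: "nat \<Rightarrow> complex" where "x c = of_nat (lin c)" for c
  obtain y where inj: "inj_on y {..<q}"
    and gen: "\<And>a b c. a < q \<Longrightarrow> b < q \<Longrightarrow> c < q \<Longrightarrow> a \<noteq> b \<Longrightarrow> a \<noteq> c \<Longrightarrow> b \<noteq> c \<Longrightarrow>
      \<not> (x a = x b \<and> x a = x c) \<Longrightarrow> area (x a, y a) (x b, y b) (x c, y c) \<noteq> 0"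
    using generic_heights[of q x] by blast
  define a where "a i e = (if e = 0 then (if i = 2 then 1 else 0)
      else if i = 0 then 1 else if i = 1 then x (cls e) else y (cls e))" for i e :: nat
  have "free_cols 3 a J \<longleftrightarrow> inj_on cls J \<and> (\<forall>l'. \<not> on_line cls lin l' J)"
    if J: "J \<subseteq> {..<N}" "card J = 3" for J
  proof (cases "0 \<in> J")
    case True
    have "finite J" using J finite_subset by blast
    then have "card (J - {0}) = 2" using True J by simp
    then obtain f g where fg: "J - {0} = {f, g}" "f \<noteq> g" by (auto simp: card_2_iff)
    have J0: "J = {0, f, g}" using insert_Diff[OF True] fg(1) by simp
    have "f \<in> J - {0}" "g \<in> J - {0}" unfolding fg(1) by simp_all
    then have ne: "f \<noteq> 0" "g \<noteq> 0" by auto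
    have "cls 0 = 0" "cls f \<noteq> 0" "cls g \<noteq> 0" using cls N J(1) ne unfolding J0 by auto
    then have "inj_on cls J \<and> (\<forall>l'. \<not> on_line cls lin l' J) \<longleftrightarrow> lin (cls f) \<noteq> lin (cls g)"
      unfolding J0 using fg(2) ne by (auto simp: on_line_def)
    moreover have "free_cols 3 a J \<longleftrightarrow> a 1 f \<noteq> a 1 g"
      unfolding J0 using ne fg(2) by (intro free_cols_vertical_iff) (auto simp: a_def)
    ultimately show ?thesis using ne by (simp add: a_def x_def)
  next
    case False
    obtain e f g where efg: "J = {e, f, g}" "e \<noteq> f" "e \<noteq> g" "f \<noteq> g"
      using J(2) by (auto simp: card_3_iff)
    have c: "cls e < q" "cls f < q" "cls g < q" "cls e \<noteq> 0" "cls f \<noteq> 0" "cls g \<noteq> 0"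
      using cls efg False J(1) by auto
    let ?p = "\<lambda>e. (x (cls e), y (cls e))"
    have "free_cols 3 a J \<longleftrightarrow> area (?p e) (?p f) (?p g) \<noteq> 0"
      unfolding efg(1) using efg False by (intro free_cols_affine_iff) (auto simp: a_def)
    also have "\<dots> \<longleftrightarrow> cls e \<noteq> cls f \<and> cls e \<noteq> cls g \<and> cls f \<noteq> cls g \<and>
        \<not> (x (cls e) = x (cls f) \<and> x (cls e) = x (cls g))"
      using gen[of "cls e" "cls f" "cls g"] c by (auto simp: area_def)
    also have "\<dots> \<longleftrightarrow> inj_on cls J \<and> (\<forall>l'. \<not> on_line cls lin l' J)"
      unfolding efg(1) using efg(2-4) c by (auto simp: on_line_def x_def)
    finally show ?thesis .
  qed
  then have "bases N 3 a = {J. J \<subseteq> {..<N} \<and> card J = 3 \<and> inj_on cls J \<and> (\<forall>l'. \<not> on_line cls lin l' J)}"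
    unfolding bases_def by blast
  then have "card (bases N 3 a) = b" using b by simp
  then show ?thesis by blast
qed

section \<open>Dependent triples\<close>

lemma choose_Suc:
  "Suc n choose 2 = (n choose 2) + n" "Suc n choose 3 = (n choose 3) + (n choose 2)"
  by (simp_all add: numeral_3_eq_3 numeral_2_eq_2)

lemma choose_0: "0 choose 2 = 0" "0 choose 3 = (0::nat)"
  by (simp_all add: binomial_eq_0)

lemma choose_2_add: "(a + b) choose 2 = (a choose 2) + a * b + (b choose 2)"
  by (induction b) (simp_all add: choose_Suc choose_0)

lemma choose_3_add:
  "(a + b) choose 3 = (a choose 3) + (a choose 2) * b + a * (b choose 2) + (b choose 3)"
  by (induction b) (simp_all add: choose_Suc choose_0 choose_2_add algebra_simps)

lemma two_choose_2: "2 * (m choose 2) + m = m * m"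
  by (induction m) (simp_all add: choose_Suc choose_0)

lemma three_choose_3: "3 * (m choose 3) + 2 * (m choose 2) = m * (m choose 2)"
proof (induction m)
  case (Suc m)
  then show ?case using two_choose_2[of m] by (simp add: choose_Suc algebra_simps)
qed (simp add: choose_0)

text \<open>
  The same data seen from the complementary side: \<open>p\<close> pairs are parallel and \<open>d\<close> triples are dependent. The current line is required to
  be fresh, so that \<open>g\<close> and \<open>h\<close> are determined by the other numbers.
\<close>

definition config :: "nat \<Rightarrow> nat \<Rightarrow> nat \<Rightarrow> bool" where
  "config N p d \<longleftrightarrow> (\<exists>P b. arrangement N P (N - 1) P b \<and> P + p = N choose 2 \<and> b + d = N choose 3)"

lemma config_start: "config 1 0 0"
  unfolding config_def using arrangement_new_line[OF arrangement_start]
  by (auto simp: choose_Suc choose_0)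

text \<open>
  The new dependent triples consist of a new element and an old parallel pair, of two new
  elements and an old one, or of three new elements.
\<close>

lemma config_add_class:
  assumes "config N p d"
  shows "config (N + m) (p + (m choose 2)) (d + m * p + N * (m choose 2) + (m choose 3))"
proof -
  obtain P b where arr: "arrangement N P (N - 1) P b" and P: "P + p = N choose 2" and b: "b + d = N choose 3"
    using assms unfolding config_def by blast
  have "arrangement (N + m) (P + m * N) (N + m - 1) (P + m * N) (b + m * P)"
    using arrangement_new_line[OF arrangement_add_class[OF arr]] .
  moreover have "P + m * N + (p + (m choose 2)) = (N + m) choose 2"
    using P by (simp add: choose_2_add mult.commute)
  moreover have "b + m * P + (d + m * p + N * (m choose 2) + (m choose 3)) = (N + m) choose 3"
    by (simp add: choose_3_add P[symmetric] b[symmetric] algebra_simps)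
  ultimately show ?thesis unfolding config_def by blast
qed

text \<open>
  The new dependent triples consist of a new point and an old parallel pair, or of three of the \<open>k + 1\<close>
  points on the new line, which include the apex.
\<close>

lemma config_add_line:
  assumes "config N p d"
  shows "config (N + k) p (d + k * p + (Suc k choose 3))"
proof -
  obtain P b where arr: "arrangement N P (N - 1) P b" and P: "P + p = N choose 2" and b: "b + d = N choose 3"
    using assms unfolding config_def by blast
  have N: "0 < N" using arr by (auto simp: arrangement_def)
  define G where "G = N - 1"
  have "arrangement (N + k) (P + k * N + (k choose 2)) (N - 1) (P + k * (N - 1))
      (b + k * P + (k choose 2) * (N - 1))"
    unfolding G_def[symmetric]
  proof (induction k)
    case 0
    then show ?case using arr by (simp add: choose_0 G_def)
  next
    case (Suc k)
    then show ?case
      using arrangement_add_class[OF Suc, of 1] by (simp add: choose_Suc algebra_simps)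
  qed
  then have "arrangement (N + k) (P + k * N + (k choose 2)) (N + k - 1) (P + k * N + (k choose 2))
      (b + k * P + (k choose 2) * (N - 1))"
    by (rule arrangement_new_line)
  moreover have "P + k * N + (k choose 2) + p = (N + k) choose 2"
    using P by (simp add: choose_2_add mult.commute)
  moreover have "b + k * P + (k choose 2) * (N - 1) + (d + k * p + (Suc k choose 3)) = (N + k) choose 3"
  proof -
    have "(k choose 2) * (N - 1) + (k choose 2) = N * (k choose 2)"
      using N by (cases N) simp_all
    then show ?thesis
      by (simp add: choose_Suc choose_3_add P[symmetric] b[symmetric] algebra_simps)
  qed
  ultimately show ?thesis unfolding config_def by blast
qed

lemma config_add_lines:
  assumes "config N 0 d"
  shows "config (N + q * k) 0 (d + q * (Suc k choose 3))"
proof (induction q)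
  case 0
  then show ?case using assms by simp
next
  case (Suc q)
  then show ?case using config_add_line[OF Suc, of k] by (simp add: algebra_simps)
qed

text \<open>
  The number \<open>d\<close> of dependent triples is \<open>(N - 2) s - 2 t + L\<close>, written without subtraction. Here \<open>L\<close> dependent triples were
  present before any classes were added, and the classes added since then contain \<open>s\<close> parallel pairs and \<open>t\<close>
  triples.
\<close>

definition stacked :: "nat \<Rightarrow> nat \<Rightarrow> nat \<Rightarrow> nat \<Rightarrow> bool" where
  "stacked L N s t \<longleftrightarrow> (\<exists>d. config N s d \<and> d + 2 * t + 2 * s = L + N * s)"

lemma stacked_start: "config N 0 L \<Longrightarrow> stacked L N 0 0"
  unfolding stacked_def by auto

text \<open>
  Since \<open>3 (m choose 3) = (m - 2) (m choose 2)\<close>, the contribution of a class to the number of dependent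
  triples depends only on its own size and the final number of elements, so the order of the classes does not matter.
\<close>

lemma stacked_add_class:
  assumes "stacked L N s t"
  shows "stacked L (N + m) (s + (m choose 2)) (t + (m choose 3))"
proof -
  obtain d where d: "config N s d" "d + 2 * t + 2 * s = L + N * s"
    using assms unfolding stacked_def by blast
  have "(d + m * s + N * (m choose 2) + (m choose 3)) + 2 * (t + (m choose 3)) + 2 * (s + (m choose 2))
      = (d + 2 * t + 2 * s) + m * s + N * (m choose 2) + (3 * (m choose 3) + 2 * (m choose 2))"
    by (simp add: algebra_simps)
  also have "\<dots> = L + (N + m) * (s + (m choose 2))"
    by (simp only: d(2) three_choose_3) (simp add: algebra_simps)
  finally show ?thesis
    unfolding stacked_def using config_add_class[OF d(1), of m] by blast
qed

lemma stacked_add_classes: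
  assumes "stacked L N s t"
  shows "stacked L (N + q * m) (s + q * (m choose 2)) (t + q * (m choose 3))"
proof (induction q)
  case 0
  then show ?case using assms by simp
next
  case (Suc q)
  then show ?case using stacked_add_class[OF Suc, of m] by (simp add: algebra_simps)
qed

text \<open>
  The number of points besides the apex that are used when \<open>R\<close> dependent triples are produced greedily by lines
  with 7, 6, 5, 4, 3 or 2 such points, that is, with 56, 35, 20, 10, 4 or 1 dependent triples.
\<close>

definition line_points :: "nat \<Rightarrow> nat" where
  "line_points R = 7 * (R div 56) + 6 * (R mod 56 div 35) + 5 * (R mod 56 mod 35 div 20)
     + 4 * (R mod 56 mod 35 mod 20 div 10) + 3 * (R mod 56 mod 35 mod 20 mod 10 div 4)
     + 2 * (R mod 56 mod 35 mod 20 mod 10 mod 4)"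

text \<open>
  The number of elements that are used when \<open>s\<close> parallel pairs are produced greedily by classes of size
  5, 4, 3 or 2, that is, with 10, 6, 3 or 1 pairs. These classes contain 10, 4, 1 or 0 triples.
\<close>

definition class_points :: "nat \<Rightarrow> nat" where
  "class_points s = 5 * (s div 10) + 4 * (s mod 10 div 6) + 3 * (s mod 10 mod 6 div 3)
     + 2 * (s mod 10 mod 6 mod 3)"

definition class_triples :: "nat \<Rightarrow> nat" where
  "class_triples s = 10 * (s div 10) + 4 * (s mod 10 div 6) + s mod 10 mod 6 div 3"

lemma choose_values:
  "Suc 7 choose 3 = 56" "Suc 6 choose 3 = 35" "Suc 5 choose 3 = 20" "Suc 4 choose 3 = 10"
  "Suc 3 choose 3 = 4" "Suc 2 choose 3 = 1" "Suc 1 choose 3 = 0"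
  "5 choose 2 = 10" "4 choose 2 = 6" "3 choose 2 = 3" "2 choose 2 = 1"
  "5 choose 3 = 10" "4 choose 3 = 4" "3 choose 3 = 1" "2 choose 3 = (0::nat)"
  by (simp_all add: eval_nat_numeral)

lemma config_of_lines:
  assumes "line_points R < n"
  shows "config n 0 R"
proof -
  define r1 r2 r3 r4 r5 where r: "r1 = R mod 56" "r2 = r1 mod 35" "r3 = r2 mod 20" "r4 = r3 mod 10" "r5 = r4 mod 4"
  define f where "f = n - 1 - line_points R"
  from config_start
  have "config (1 + R div 56 * 7) 0 (0 + R div 56 * (Suc 7 choose 3))"
    by (rule config_add_lines)
  from config_add_lines[OF this, of "r1 div 35" 6]
  have "config (1 + R div 56 * 7 + r1 div 35 * 6) 0 (R div 56 * 56 + r1 div 35 * 35)"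
    by (simp only: choose_values add_0)
  from config_add_lines[OF this, of "r2 div 20" 5]
  have "config (1 + R div 56 * 7 + r1 div 35 * 6 + r2 div 20 * 5) 0
      (R div 56 * 56 + r1 div 35 * 35 + r2 div 20 * 20)"
    by (simp only: choose_values)
  from config_add_lines[OF this, of "r3 div 10" 4]
  have "config (1 + R div 56 * 7 + r1 div 35 * 6 + r2 div 20 * 5 + r3 div 10 * 4) 0
      (R div 56 * 56 + r1 div 35 * 35 + r2 div 20 * 20 + r3 div 10 * 10)"
    by (simp only: choose_values)
  from config_add_lines[OF this, of "r4 div 4" 3]
  have "config (1 + R div 56 * 7 + r1 div 35 * 6 + r2 div 20 * 5 + r3 div 10 * 4 + r4 div 4 * 3) 0
      (R div 56 * 56 + r1 div 35 * 35 + r2 div 20 * 20 + r3 div 10 * 10 + r4 div 4 * 4)"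
    by (simp only: choose_values)
  from config_add_lines[OF this, of r5 2]
  have "config (1 + R div 56 * 7 + r1 div 35 * 6 + r2 div 20 * 5 + r3 div 10 * 4 + r4 div 4 * 3 + r5 * 2) 0
      (R div 56 * 56 + r1 div 35 * 35 + r2 div 20 * 20 + r3 div 10 * 10 + r4 div 4 * 4 + r5 * 1)"
    by (simp only: choose_values)
  \<comment> \<open>a line with a single point besides the apex has no dependent triples and serves as padding\<close>
  from config_add_lines[OF this, of f 1]
  have "config (1 + R div 56 * 7 + r1 div 35 * 6 + r2 div 20 * 5 + r3 div 10 * 4 + r4 div 4 * 3 + r5 * 2 + f * 1) 0
      (R div 56 * 56 + r1 div 35 * 35 + r2 div 20 * 20 + r3 div 10 * 10 + r4 div 4 * 4 + r5 * 1 + f * 0)"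
    by (simp only: choose_values)
  moreover have "1 + R div 56 * 7 + r1 div 35 * 6 + r2 div 20 * 5 + r3 div 10 * 4 + r4 div 4 * 3 + r5 * 2 + f * 1 = n"
  proof -
    have "line_points R = R div 56 * 7 + r1 div 35 * 6 + r2 div 20 * 5 + r3 div 10 * 4 + r4 div 4 * 3 + r5 * 2"
      unfolding line_points_def r by (simp only: mult.commute)
    then show ?thesis using assms unfolding f_def by linarith
  qed
  moreover have "R div 56 * 56 + r1 div 35 * 35 + r2 div 20 * 20 + r3 div 10 * 10 + r4 div 4 * 4 + r5 * 1 + f * 0 = R"
    unfolding r by simp
  ultimately show ?thesis by simp
qed

text \<open>
  The numbers of points on lines and in classes leave room for the apex among \<open>N\<close> elements, hence the strict inequality.
\<close>

definition fits :: "nat \<Rightarrow> nat \<Rightarrow> nat \<Rightarrow> bool" where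
  "fits N d s \<longleftrightarrow> (N - 2) * s \<le> d + 2 * class_triples s \<and>
     line_points (d + 2 * class_triples s - (N - 2) * s) + class_points s < N"

lemma config_of_fits:
  assumes N: "2 \<le> N" and "fits N d s"
  shows "\<exists>p. config N p d"
proof -
  have off: "(N - 2) * s \<le> d + 2 * class_triples s"
    and fit: "line_points (d + 2 * class_triples s - (N - 2) * s) + class_points s < N"
    using assms(2) by (simp_all add: fits_def)
  define L where "L = d + 2 * class_triples s - (N - 2) * s"
  define n where "n = N - class_points s"
  define r1 r2 r3 where r: "r1 = s mod 10" "r2 = r1 mod 6" "r3 = r2 mod 3"
  have "config n 0 L" using fit by (intro config_of_lines) (simp add: L_def n_def)
  from stacked_start[OF this]
  have "stacked L (n + s div 10 * 5) (0 + s div 10 * (5 choose 2)) (0 + s div 10 * (5 choose 3))"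
    by (rule stacked_add_classes)
  from stacked_add_classes[OF this, of "r1 div 6" 4]
  have "stacked L (n + s div 10 * 5 + r1 div 6 * 4) (s div 10 * 10 + r1 div 6 * 6) (s div 10 * 10 + r1 div 6 * 4)"
    by (simp only: choose_values add_0)
  from stacked_add_classes[OF this, of "r2 div 3" 3]
  have "stacked L (n + s div 10 * 5 + r1 div 6 * 4 + r2 div 3 * 3)
      (s div 10 * 10 + r1 div 6 * 6 + r2 div 3 * 3) (s div 10 * 10 + r1 div 6 * 4 + r2 div 3 * 1)"
    by (simp only: choose_values)
  from stacked_add_classes[OF this, of r3 2]
  have "stacked L (n + s div 10 * 5 + r1 div 6 * 4 + r2 div 3 * 3 + r3 * 2)
      (s div 10 * 10 + r1 div 6 * 6 + r2 div 3 * 3 + r3 * 1)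
      (s div 10 * 10 + r1 div 6 * 4 + r2 div 3 * 1 + r3 * 0)"
    by (simp only: choose_values)
  moreover have "n + s div 10 * 5 + r1 div 6 * 4 + r2 div 3 * 3 + r3 * 2 = N"
  proof -
    have "class_points s = s div 10 * 5 + r1 div 6 * 4 + r2 div 3 * 3 + r3 * 2"
      unfolding class_points_def r by (simp only: mult.commute)
    then show ?thesis using fit unfolding n_def by linarith
  qed
  moreover have "s div 10 * 10 + r1 div 6 * 6 + r2 div 3 * 3 + r3 * 1 = s"
    unfolding r by simp
  moreover have "s div 10 * 10 + r1 div 6 * 4 + r2 div 3 * 1 + r3 * 0 = class_triples s"
    unfolding class_triples_def r by simp
  ultimately have "stacked L N s (class_triples s)" by simp
  then obtain d' where d': "config N s d'" "d' + 2 * class_triples s + 2 * s = L + N * s"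
    unfolding stacked_def by blast
  have "N * s = (N - 2) * s + 2 * s" using N by (simp add: algebra_simps flip: add_mult_distrib)
  then have "d' = d" using d'(2) off unfolding L_def by linarith
  then show ?thesis using d'(1) by blast
qed

text \<open>
  The constant is attained at \<open>R = 52 = 35 + 10 + 4 + 1 + 1 + 1\<close>. Lines with seven points have more than six
  dependent triples per point, so it suffices to look at the remainders modulo 56.
\<close>

lemma line_points_le: "6 * line_points R \<le> R + 62"
proof -
  have small: "\<forall>r\<in>set [0..<56]. 6 * line_points r \<le> r + 62" by code_simp
  have "line_points R = 7 * (R div 56) + line_points (R mod 56)"
    by (simp add: line_points_def)
  moreover have "6 * line_points (R mod 56) \<le> R mod 56 + 62" using small by simp
  moreover have "R = 56 * (R div 56) + R mod 56" by simp
  ultimately show ?thesis by linarith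
qed

text \<open>
  The constant is attained at \<open>s = 5 = 3 + 1 + 1\<close>. For classes of size five both sides grow by the same amount,
  so it suffices to look at the remainders modulo 10.
\<close>

lemma class_points_le: "6 * class_points s + 2 * class_triples s \<le> 5 * s + 19"
proof -
  have small: "\<forall>r\<in>set [0..<10]. 6 * class_points r + 2 * class_triples r \<le> 5 * r + 19" by code_simp
  have "class_points s = 5 * (s div 10) + class_points (s mod 10)"
    "class_triples s = 10 * (s div 10) + class_triples (s mod 10)"
    by (simp_all add: class_points_def class_triples_def)
  moreover have "6 * class_points (s mod 10) + 2 * class_triples (s mod 10) \<le> 5 * (s mod 10) + 19"
    using small by simp
  moreover have "s = 10 * (s div 10) + s mod 10" by simp
  ultimately show ?thesis by linarith
qed

text \<open>
  With \<open>s\<close> the quotient of \<open>d\<close> by \<open>N - 2\<close>, the lines have to supply at most \<open>N - 3 + 2 t\<close> dependent triples.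
  By the two bounds, \<open>12\<close> times the number of points is then at most \<open>156 + 2 N + 10 s\<close>, and
  \<open>2 s \<le> N - 2\<close> makes this at most \<open>146 + 7 N\<close>, which is less than \<open>12 N\<close>.
\<close>

lemma config_large:
  assumes N: "30 \<le> N" and d: "2 * d < (N - 1) * (N - 2)"
  shows "\<exists>p. config N p d"
proof (rule config_of_fits)
  define s where "s = d div (N - 2)"
  have ds: "d = (N - 2) * s + d mod (N - 2)" by (simp add: s_def)
  have r: "d mod (N - 2) < N - 2" using N by simp
  have "(2 * s) * (N - 2) < (N - 1) * (N - 2)"
  proof -
    have "(N - 2) * s \<le> d" using ds by linarith
    then have "(2 * s) * (N - 2) \<le> 2 * d" by (simp add: mult.commute)
    then show ?thesis using d by linarith
  qed
  then have s: "2 * s < N - 1" by simp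
  show "2 \<le> N" using N by simp
  have off: "(N - 2) * s \<le> d + 2 * class_triples s" using ds by linarith
  have R: "d + 2 * class_triples s - (N - 2) * s = d mod (N - 2) + 2 * class_triples s"
    using ds by linarith
  have "6 * line_points (d mod (N - 2) + 2 * class_triples s) \<le> d mod (N - 2) + 2 * class_triples s + 62"
    by (rule line_points_le)
  then have "line_points (d mod (N - 2) + 2 * class_triples s) + class_points s < N"
    using class_points_le[of s] r s N by linarith
  then have "fits N d s" unfolding fits_def R using off by simp
  then show "fits N d (d div (N - 2))" by (simp only: s_def)
qed

section \<open>Fewer than thirty elements\<close>

text \<open>
  An arrangement is given by a list of lines, each a list of class sizes, and the tuple
  \<open>(N, P, g, h, b)\<close> of its numbers is computed by adding the classes one after the other.
\<close>

fun add_classes :: "nat list \<Rightarrow> nat \<times> nat \<times> nat \<times> nat \<times> nat \<Rightarrow> nat \<times> nat \<times> nat \<times> nat \<times> nat" where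
  "add_classes [] st = st"
| "add_classes (m # ms) (N, P, g, h, b) = add_classes ms (N + m, P + m * N, g, h + m * g, b + m * h)"

fun build :: "nat list list \<Rightarrow> nat \<times> nat \<times> nat \<times> nat \<times> nat \<Rightarrow> nat \<times> nat \<times> nat \<times> nat \<times> nat" where
  "build [] st = st"
| "build (ms # mss) (N, P, g, h, b) = build mss (add_classes ms (N, P, N - 1, P, b))"

lemma arrangement_add_classes:
  "case st of (N, P, g, h, b) \<Rightarrow> arrangement N P g h b \<Longrightarrow>
   case add_classes ms st of (N, P, g, h, b) \<Rightarrow> arrangement N P g h b"
proof (induction ms st rule: add_classes.induct)
  case (2 m ms N P g h b)
  then show ?case using arrangement_add_class[of N P g h b m] by simp
qed simp

lemma arrangement_build:
  "case st of (N, P, g, h, b) \<Rightarrow> arrangement N P g h b \<Longrightarrow>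
   case build mss st of (N, P, g, h, b) \<Rightarrow> arrangement N P g h b"
proof (induction mss st rule: build.induct)
  case (2 ms mss N P g h b)
  then show ?case
    using arrangement_new_line[of N P g h b] arrangement_add_classes[of "(N, P, N - 1, P, b)" ms] by simp
qed simp

lemma arrangement_of_lines:
  assumes "build mss (1, 0, 0, 0, 0) = (N, P, g, h, b)"
  shows "\<exists>a. card (bases N 3 a) = b"
  using arrangement_build[of "(1, 0, 0, 0, 0)" mss] arrangement_start arrangement_realizable assms
  by fastforce

text \<open>
  Arrangements of \<open>N\<close> elements with \<open>d\<close> dependent triples for the values of \<open>d\<close> at which the greedy
  decompositions use too many points. Many of them have a line with a class of parallel elements and a further point.
\<close>

definition sporadic :: "(nat \<times> nat \<times> nat list list) list" where
  "sporadic =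
    [(5, 5, [[2, 1], [1]]),
     (6, 6, [[2, 1], [1], [1]]),
     (6, 7, [[2, 1], [1, 1]]),
     (7, 12, [[2, 1], [2], [1]]),
     (8, 9, [[2, 1], [1, 1], [1], [1]]),
     (8, 15, [[2, 1], [2], [1, 1]]),
     (8, 19, [[2, 1, 1], [2], [1]]),
     (9, 13, [[2, 1], [1, 1, 1], [1], [1]]),
     (9, 22, [[2], [2], [2], [1, 1]]),
     (9, 25, [[2, 1], [2, 1], [2]]),
     (10, 35, [[3, 1], [2, 1], [1], [1]]),
     (11, 16, [[2, 1], [1, 1, 1], [1, 1], [1], [1]]),
     (11, 32, [[2, 1], [2, 1], [2], [1, 1]]),
     (11, 37, [[2, 2], [2, 1], [1, 1, 1]]),
     (11, 40, [[3, 1], [2, 1], [1, 1], [1]]),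
     (11, 41, [[2, 2], [1, 1, 1, 1], [2]]),
     (11, 42, [[2, 2, 1], [2, 1], [1, 1]]),
     (12, 27, [[2, 1], [1, 1, 1], [1, 1], [2], [1]]),
     (12, 44, [[2, 2], [1, 1, 1, 1], [2], [1]]),
     (12, 47, [[3, 1], [2, 1], [1, 1, 1], [1]]),
     (12, 51, [[2, 1, 1, 1], [2, 2], [1, 1]]),
     (13, 49, [[2, 1, 1, 1], [2, 1, 1], [1, 1, 1]]),
     (13, 65, [[2, 2, 1], [2, 1, 1], [2, 1]]),
     (14, 53, [[3, 1, 1], [1, 1, 1], [1, 1, 1], [1, 1]])]"

lemma choose_3_times_6: "6 * (n choose 3) = n * (n - 1) * (n - 2)"
proof (cases n)
  case (Suc k)
  have "6 * (Suc k choose 3) = Suc k * k * (k - 1)"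
  proof (induction k)
    case (Suc k)
    then show ?case using two_choose_2[of "Suc k"] by (cases k) (simp_all add: choose_Suc choose_0 algebra_simps)
  qed (simp add: choose_Suc choose_0)
  then show ?thesis using Suc by simp
qed (simp add: choose_0)

lemma choose_2_times_2: "2 * (n choose 2) = n * (n - 1)"
  using two_choose_2[of n] by (cases n) simp_all

text \<open>
  The factor 6 clears the denominator of the binomial coefficient \<open>N choose 3 = b + d\<close>.
\<close>

lemma sporadic_correct:
  "\<forall>(N, d, mss)\<in>set sporadic. case build mss (1, 0, 0, 0, 0) of (N', P, g, h, b) \<Rightarrow>
     N' = N \<and> 6 * (b + d) = N * (N - 1) * (N - 2)"
  by code_simp

text \<open>
  Changing \<open>s\<close> by one shifts the number of dependent triples that the lines have to supply by about \<open>N - 2\<close>. This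
  may lead to a value with a shorter decomposition.
\<close>

lemma small_cases:
  "\<forall>N\<in>set [3..<30]. \<forall>d\<in>set [0..<(N - 1) * (N - 2) div 2].
     (let s = d div (N - 2) in
      if fits N d s then True
      else if fits N d (Suc s) then True
      else if fits N d (s - 1) then True
      else if fits N d (s - 2) then True
      else if fits N d (s - 3) then True
      else if N = 6 \<and> (d = 3 \<or> d = 9) then True
      else (N, d) \<in> set (map (\<lambda>(N, d, mss). (N, d)) sporadic))"
  by code_simp

text \<open>
  The vertices of a triangle and one further point on each side: exactly three of the twenty triples are
  collinear. Three lines in general position have no common point, so this configuration is not an arrangement of lines through an apex.
\<close>

lemma realizable_6_3_17: "realizable 6 3 17"
proof -
  \<comment> \<open>the vertices are \<open>(0, 0)\<close>, \<open>(4, 0)\<close> and \<open>(0, 4)\<close>\<close>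
  define x :: "nat \<Rightarrow> int" where "x e = [0, 4, 0, 1, 0, 1] ! e" for e
  define y :: "nat \<Rightarrow> int" where "y e = [0, 0, 4, 0, 1, 3] ! e" for e
  define a :: "nat \<Rightarrow> nat \<Rightarrow> complex" where
    "a i e = (if i = 0 then 1 else if i = 1 then of_int (x e) else of_int (y e))" for i e
  define \<T> :: "nat set set" where "\<T> = {{0, 1, 3}, {0, 2, 4}, {1, 2, 5}}"
  have area: "(x f - x e) * (y g - y e) - (x g - x e) * (y f - y e) = 0 \<longleftrightarrow> {e, f, g} \<in> \<T>"
    if "e < f" "f < g" "g < 6" for e f g
  proof -
    have "e \<in> {0,1,2,3}" "f \<in> {1,2,3,4}" "g \<in> {2,3,4,5}" using that by auto
    then show ?thesis
      using that unfolding \<T>_def x_def y_def by (elim insertE) (simp_all add: set_eq_subset)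
  qed
  have "free_cols 3 a J \<longleftrightarrow> J \<notin> \<T>" if J: "J \<subseteq> {..<6}" "card J = 3" for J
  proof -
    obtain p q r where pqr: "J = {p, q, r}" "p \<noteq> q" "p \<noteq> r" "q \<noteq> r"
      using J(2) by (auto simp: card_3_iff)
    have "\<exists>e f g. J = {e, f, g} \<and> e < f \<and> f < g"
    proof -
      consider "p < q" "q < r" | "p < r" "r < q" | "q < p" "p < r" | "q < r" "r < p" | "r < p" "p < q" | "r < q" "q < p"
        using pqr(2-4) by linarith
      then show ?thesis using pqr(1) by cases (metis insert_commute)+
    qed
    then obtain e f g where efg: "J = {e, f, g}" "e < f" "f < g" by blast
    have "free_cols 3 a J \<longleftrightarrow>
        area (of_int (x e), of_int (y e)) (of_int (x f), of_int (y f)) (of_int (x g), of_int (y g)) \<noteq> 0"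
      unfolding efg(1) using efg(2,3)
      by (intro free_cols_affine_iff[where p = "\<lambda>e. (of_int (x e), of_int (y e))"]) (auto simp: a_def)
    also have "\<dots> \<longleftrightarrow> of_int ((x f - x e) * (y g - y e) - (x g - x e) * (y f - y e)) \<noteq> (0 :: complex)"
      by (simp add: area_def)
    also have "\<dots> \<longleftrightarrow> J \<notin> \<T>"
      using area[of e f g] efg J(1) by (simp only: of_int_eq_0_iff) auto
    finally show ?thesis .
  qed
  then have "bases 6 3 a = {J. J \<subseteq> {..<6} \<and> card J = 3} - \<T>"
    unfolding bases_def by blast
  moreover have "card {J. J \<subseteq> {..<6::nat} \<and> card J = 3} = 20"
    by (simp add: n_subsets) (simp add: choose_Suc choose_0 eval_nat_numeral)
  moreover have "\<T> \<subseteq> {J. J \<subseteq> {..<6} \<and> card J = 3}" by (auto simp: \<T>_def)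
  moreover have "card \<T> = 3"
  proof -
    have "{0, 1, 3} \<noteq> {0, 2, 4 :: nat}" "{0, 1, 3} \<noteq> {1, 2, 5 :: nat}" "{0, 2, 4} \<noteq> {1, 2, 5 :: nat}"
      by auto
    then show ?thesis unfolding \<T>_def by simp
  qed
  ultimately have "card (bases 6 3 a) = 17"
    by (simp add: card_Diff_subset finite_subset[of \<T>])
  then show ?thesis unfolding realizable_def by blast
qed

section \<open>Rank two\<close>

text \<open>
  In rank two there is no apex, and only the partition into parallel classes matters.
\<close>

definition class_pairs :: "nat \<Rightarrow> nat \<Rightarrow> bool" where
  "class_pairs N P \<longleftrightarrow> (\<exists>cls :: nat \<Rightarrow> nat. card {J. J \<subseteq> {..<N} \<and> card J = 2 \<and> inj_on cls J} = P)"

lemma class_pairs_0: "class_pairs 0 0"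
  unfolding class_pairs_def by auto

lemma class_pairs_add_class:
  assumes "class_pairs N P"
  shows "class_pairs (N + m) (P + m * N)"
proof -
  obtain cls :: "nat \<Rightarrow> nat" where P: "card {J. J \<subseteq> {..<N} \<and> card J = 2 \<and> inj_on cls J} = P"
    using assms unfolding class_pairs_def by blast
  obtain q where q: "\<And>e. e < N \<Longrightarrow> cls e < q"
    using finite_nat_set_iff_bounded[of "cls ` {..<N}"] by auto
  define cls' where "cls' e = (if e < N then cls e else q)" for e
  have "card {J. J \<subseteq> {..<N+m} \<and> card J = Suc 1 \<and> inj_on cls' J} =
      card {J. J \<subseteq> {..<N} \<and> card J = Suc 1 \<and> inj_on cls' J} + m * card {J. J \<subseteq> {..<N} \<and> card J = 1 \<and> True}"
  proof (rule card_subsets_add_class)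
    fix A y assume A: "A \<subseteq> {..<N}" "card A = 1" "y \<in> {N..<N+m}"
    then obtain e where "A = {e}" "e < N" by (auto simp: card_1_singleton_iff)
    then show "inj_on cls' (insert y A) \<longleftrightarrow> True"
      using q[of e] A(3) by (auto simp: cls'_def)
  qed (auto simp: inj_on_def cls'_def)
  moreover have "{J. J \<subseteq> {..<N} \<and> card J = 2 \<and> inj_on cls' J} = {J. J \<subseteq> {..<N} \<and> card J = 2 \<and> inj_on cls J}"
    by (intro Collect_cong conj_cong refl inj_on_cong) (auto simp: cls'_def)
  moreover have "card {J. J \<subseteq> {..<N} \<and> card J = 1} = N" by (simp add: n_subsets)
  ultimately have "card {J. J \<subseteq> {..<N+m} \<and> card J = 2 \<and> inj_on cls' J} = P + m * N"
    using P unfolding Suc_1 by simp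
  then show ?thesis unfolding class_pairs_def by blast
qed

lemma realizable_class_pairs:
  assumes "class_pairs N P"
  shows "realizable N 2 P"
proof -
  obtain cls :: "nat \<Rightarrow> nat" where P: "card {J. J \<subseteq> {..<N} \<and> card J = 2 \<and> inj_on cls J} = P"
    using assms unfolding class_pairs_def by blast
  define a :: "nat \<Rightarrow> nat \<Rightarrow> complex" where "a i e = (if i = 0 then 1 else of_nat (cls e))" for i e
  have "free_cols 2 a J \<longleftrightarrow> inj_on cls J" if J: "card J = 2" for J
  proof -
    obtain e f where ef: "J = {e, f}" "e \<noteq> f" using J by (auto simp: card_2_iff)
    have free: "free_cols 2 a {e, f} \<longleftrightarrow>
        (\<forall>z :: nat \<Rightarrow> complex. z e + z f = 0 \<and> z e * of_nat (cls e) + z f * of_nat (cls f) = 0 \<longrightarrow> z e = 0 \<and> z f = 0)"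
      unfolding free_cols_def using ef(2) by (simp add: a_def less_2_cases_iff all_conj_distrib)
    have "free_cols 2 a {e, f} \<longleftrightarrow> cls e \<noteq> cls f"
    proof
      assume "free_cols 2 a {e, f}"
      from spec[OF this[unfolded free], of "\<lambda>i. if i = e then 1 else - 1"]
      show "cls e \<noteq> cls f" using ef(2) by auto
    next
      assume ne: "cls e \<noteq> cls f"
      show "free_cols 2 a {e, f}"
        unfolding free
      proof (intro allI impI)
        fix z :: "nat \<Rightarrow> complex"
        assume z: "z e + z f = 0 \<and> z e * of_nat (cls e) + z f * of_nat (cls f) = 0"
        then have "z f = - z e" by (simp add: add_eq_0_iff)
        with z have "z e * (of_nat (cls e) - of_nat (cls f)) = 0" by (simp add: right_diff_distrib)
        then show "z e = 0 \<and> z f = 0" using ne \<open>z f = - z e\<close> by simp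
      qed
    qed
    then show ?thesis using ef by simp
  qed
  then have "bases N 2 a = {J. J \<subseteq> {..<N} \<and> card J = 2 \<and> inj_on cls J}"
    unfolding bases_def by blast
  then have "card (bases N 2 a) = P" using P by simp
  then show ?thesis unfolding realizable_def by blast
qed

text \<open>
  Classes of size three contribute as many parallel pairs as they have elements, and at most two classes of size two are
  needed for the remainder of \<open>d\<close> modulo three; so \<open>d + 2\<close> elements suffice for \<open>d\<close> parallel pairs.
\<close>

lemma class_pairs_of_deficit:
  "d + 2 \<le> N \<Longrightarrow> \<exists>P. class_pairs N P \<and> P + d = N choose 2"
proof (induction d arbitrary: N rule: less_induct)
  case (less d)
  have add: "\<exists>P'. class_pairs M' P' \<and> P' + (x + (m choose 2)) = M' choose 2"
    if "class_pairs M P" "P + x = M choose 2" "M + m = M'" for M M' P m x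
  proof (intro exI conjI)
    show "class_pairs M' (P + m * M)" using class_pairs_add_class[OF that(1)] that(3) by blast
    show "P + m * M + (x + (m choose 2)) = M' choose 2"
      using that(2) unfolding that(3)[symmetric] by (simp add: choose_2_add mult.commute)
  qed
  have zero: "\<exists>P. class_pairs M P \<and> P + 0 = M choose 2" for M
  proof (induction M)
    case 0
    then show ?case using class_pairs_0 by (auto simp: choose_0)
  next
    case (Suc M)
    then obtain P where P: "class_pairs M P" "P + 0 = M choose 2" by blast
    show ?case using add[OF P, of 1 "Suc M"] by (simp add: choose_Suc choose_0)
  qed
  have c: "(2::nat) choose 2 = 1" "(3::nat) choose 2 = 3" by (simp_all add: choose_Suc choose_0 eval_nat_numeral)
  consider "d = 0" | "d = 1" | "d = 2" | "3 \<le> d" by linarith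
  then show ?case
  proof cases
    case 1
    then show ?thesis using zero by simp
  next
    case 2
    obtain P where "class_pairs (N - 2) P" "P + 0 = (N - 2) choose 2" using zero by blast
    from add[OF this, of 2 N] show ?thesis using 2 less.prems by (simp add: c)
  next
    case 3
    obtain P where P: "class_pairs (N - 4) P" "P + 0 = (N - 4) choose 2" using zero by blast
    have "N - 4 + 2 = N - 2" using 3 less.prems by simp
    from add[OF P this] obtain P' where "class_pairs (N - 2) P'" "P' + 1 = (N - 2) choose 2"
      by (auto simp: c)
    from add[OF this, of 2 N] show ?thesis using 3 less.prems by (simp add: c)
  next
    case 4
    then have "d - 3 < d" "d - 3 + 2 \<le> N - 3" using less.prems by auto
    from less.IH[OF this] obtain P where "class_pairs (N - 3) P" "P + (d - 3) = (N - 3) choose 2" by blast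
    from add[OF this, of 3 N] show ?thesis using 4 less.prems by (simp add: c)
  qed
qed

lemma realizable_rank_2:
  "1 \<le> b \<Longrightarrow> b \<le> N choose 2 \<Longrightarrow> realizable N 2 b"
proof (induction N)
  case 0
  then show ?case by (simp add: choose_0)
next
  case (Suc N)
  show ?case
  proof (cases "b \<le> N choose 2")
    case True
    then show ?thesis using Suc realizable_add_loops[of N 2 b "Suc N"] by simp
  next
    case False
    define d where "d = (Suc N choose 2) - b"
    have "d + 2 \<le> Suc N" using False Suc.prems by (auto simp: d_def choose_Suc)
    then obtain P where "class_pairs (Suc N) P" "P + d = Suc N choose 2"
      using class_pairs_of_deficit by blast
    moreover have "b + d = Suc N choose 2" using Suc.prems by (simp add: d_def)
    ultimately have "class_pairs (Suc N) b" by (metis add_right_cancel)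
    then show ?thesis by (rule realizable_class_pairs)
  qed
qed

section \<open>Rank three\<close>

lemma realizable_config:
  assumes "config N p d" and "b + d = N choose 3"
  shows "realizable N 3 b"
proof -
  obtain P b' where arr: "arrangement N P (N - 1) P b'" and b': "b' + d = N choose 3"
    using assms(1) unfolding config_def by blast
  then have "b' = b" using assms(2) by simp
  then show ?thesis using arrangement_realizable[OF arr] unfolding realizable_def by simp
qed

lemma realizable_rank_3_small:
  assumes N: "3 \<le> N" "N < 30" and d: "d < (N - 1) choose 2" and b: "b + d = N choose 3"
    and exc: "(N, b) \<noteq> (6, 11)"
  shows "realizable N 3 b"
proof -
  define s where "s = d div (N - 2)"
  have "N - 1 - 1 = N - 2" by simp
  with d have "d < (N - 1) * (N - 2) div 2" by (simp only: choose_two)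
  then have "N \<in> set [3..<30]" "d \<in> set [0..<(N - 1) * (N - 2) div 2]"
    using N unfolding set_upt by simp_all
  then have "fits N d s \<or> fits N d (Suc s) \<or> fits N d (s - 1) \<or> fits N d (s - 2) \<or>
      fits N d (s - 3) \<or> (N = 6 \<and> (d = 3 \<or> d = 9)) \<or>
      (N, d) \<in> set (map (\<lambda>(N, d, mss). (N, d)) sporadic)"
    using small_cases unfolding Let_def s_def by meson
  then consider s where "fits N d s" | "N = 6" "d = 3" | "N = 6" "d = 9" | mss where "(N, d, mss) \<in> set sporadic"
    by (auto simp del: set_simps)
  then show ?thesis
  proof cases
    case (1 s)
    then have "\<exists>p. config N p d"
      using N(1) by (intro config_of_fits[of N d s]) auto
    then show ?thesis using realizable_config b by blast
  next
    case 2
    then have "b = 17" using b by (simp add: choose_Suc choose_0 eval_nat_numeral)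
    then show ?thesis using realizable_6_3_17 2 by simp
  next
    case 3
    then have "b = 11" using b by (simp add: choose_Suc choose_0 eval_nat_numeral)
    then show ?thesis using exc 3 by simp
  next
    case (4 mss)
    obtain N' P g h b' where build: "build mss (1, 0, 0, 0, 0) = (N', P, g, h, b')"
      by (metis prod_cases5)
    then have "N' = N" and "6 * (b' + d) = N * (N - 1) * (N - 2)"
      using bspec[OF sporadic_correct 4] by auto
    then have "6 * (b' + d) = 6 * (b + d)" using choose_3_times_6[of N] b by simp
    then have "b' = b" by simp
    then show ?thesis
      using arrangement_of_lines[OF build] \<open>N' = N\<close> unfolding realizable_def by simp
  qed
qed

text \<open>
  If a column cannot be dropped, then the number \<open>d\<close> of dependent triples of columns is less than \<open>N choose 2\<close> for
  \<open>N + 1\<close> columns, which is the range covered by the arrangements.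
\<close>

lemma realizable_rank_3:
  "1 \<le> b \<Longrightarrow> b \<le> N choose 3 \<Longrightarrow> (N, b) \<noteq> (6, 11) \<Longrightarrow> realizable N 3 b"
proof (induction N)
  case 0
  then show ?case by (simp add: choose_0)
next
  case (Suc N)
  show ?case
  proof (cases "b \<le> N choose 3")
    case True
    show ?thesis
    proof (cases "(N, b) = (6, 11)")
      case True
      \<comment> \<open>six columns do not suffice here, so all seven are used: a line with a triple and a double point, and a point off it\<close>
      have "build [[3, 2], [1]] (1, 0, 0, 0, 0) = (7, 17, 5, 16, 11)" by simp
      from arrangement_of_lines[OF this] show ?thesis using True unfolding realizable_def by simp
    next
      case False
      then show ?thesis using Suc True realizable_add_loops[of N 3 b "Suc N"] by simp
    qed
  next
    case False
    define d where "d = (Suc N choose 3) - b"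
    have b: "b + d = Suc N choose 3" using Suc.prems by (simp add: d_def)
    have d: "d < N choose 2" using False b by (simp add: choose_Suc)
    have N: "2 \<le> N"
    proof (rule ccontr)
      assume "\<not> 2 \<le> N"
      then have "N choose 2 = 0" by (simp add: binomial_eq_0)
      then show False using d by linarith
    qed
    show ?thesis
    proof (cases "Suc N < 30")
      case True
      then show ?thesis using realizable_rank_3_small[of "Suc N" d b] N d b Suc.prems by simp
    next
      case False
      have "2 * d < (Suc N - 1) * (Suc N - 2)"
        using d choose_2_times_2[of N] by simp
      then show ?thesis using config_large[of "Suc N" d] False realizable_config[OF _ b] by auto
    qed
  qed
qed

section \<open>All ranks\<close>

lemma realizable_corank_le_3:
  assumes "c \<le> 3" and "1 \<le> b" and "b \<le> (r + c) choose r" and "(r + c, r, b) \<noteq> (6, 3, 11)"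
  shows "realizable (r + c) r b"
proof -
  have b: "b \<le> (r + c) choose c"
    using assms(3) binomial_symmetric[of r "r + c"] by simp
  have "realizable (r + c) c b"
  proof -
    consider "c = 0" | "c = 1" | "c = 2" | "c = 3" using assms(1) by linarith
    then show ?thesis
    proof cases
      case 1
      then have "b = 1" using b assms(2) by simp
      then show ?thesis using realizable_rank_0 1 by simp
    next
      case 2
      then show ?thesis using b realizable_rank_1 by simp
    next
      case 3
      then show ?thesis using b assms(2) realizable_rank_2 by simp
    next
      case 4
      then show ?thesis using b assms(2,4) realizable_rank_3 by auto
    qed
  qed
  from realizable_dual[OF this] show ?thesis using assms(2) by simp
qed

text \<open>
  When \<open>n > r + 3\<close>, dropping zero columns leads to \<open>r + 3\<close> columns, except that \<open>(6, 3, 11)\<close> must not be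
  reached; for \<open>r = 3\<close> and \<open>b = 11\<close> one stops at seven columns.
\<close>

theorem theorem4p4:
  fixes n r b :: nat
  assumes "n > 0" and "r > 0" and "b > 0"
    and "(n, r, b) \<noteq> (6, 3, 11)"
    and "1 \<le> b" and "b \<le> n choose r"
    and "b \<le> (r + 3) choose 3"
  shows "\<exists>A. nrb_matrix n r b A"
proof -
  have "realizable n r b"
  proof (cases "n \<le> r + 3")
    case True
    have "r \<le> n"
    proof (rule ccontr)
      assume "\<not> r \<le> n"
      then have "n choose r = 0" by (simp add: binomial_eq_0)
      then show False using assms(5,6) by linarith
    qed
    then show ?thesis
      using realizable_corank_le_3[of "n - r" b r] True assms by simp
  next
    case False
    show ?thesis
    proof (cases "(r, b) = (3, 11)")
      case True
      have "7 choose 3 = (35::nat)" by (simp add: choose_Suc choose_0 eval_nat_numeral)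
      then have "realizable 7 3 11" by (intro realizable_rank_3) auto
      then show ?thesis using realizable_add_loops[of 7 3 11 n] True \<open>\<not> n \<le> r + 3\<close> by simp
    next
      case ne: False
      have "b \<le> (r + 3) choose r" using assms(7) binomial_symmetric[of r "r + 3"] by simp
      then have "realizable (r + 3) r b"
        using ne assms(5) by (intro realizable_corank_le_3) auto
      then show ?thesis using realizable_add_loops False by simp
    qed
  qed
  then show ?thesis using nrb_matrix_of_bases unfolding realizable_def by blast
qed

end
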